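(* Let $d\in\{2,3\}$, let $\Omega\subset\mathbb{R}^d$ be a bounded domain with smooth boundary, let $D(x)>0$ be a smoothly varying diffusivity on $\Omega$, and set $M(x)=1/D(x)$, $|M|=\int_\Omega M(x)\,dx$, $\mu(x)=M(x)/|M|$. Let $\kappa>0$. For a trap density $\rho$ (that is, $\rho\ge 0$ on $\Omega$ and $\int_\Omega\rho\,dx=1$), let $u=u_\rho$ be the solution of $$\Delta u-\kappa\,\rho(x)\,u=-M(x)\ \text{ in }\Omega,\qquad \partial_n u=0\ \text{ on }\partial\Omega .$$ Then the worst-case mean capture time $\max_{x\in\Omega}u_\rho(x)$ is minimized, over all trap densities $\rho$, by choosing $\rho=\mu$, in which case $u_\mu$ is everywhere constant: $u_\mu(x)=|M|/\kappa$ for all $x\in\Omega$. In other words, $\rho=\mu$ solves the mini-max problem $\min_{\rho\ \text{density}}\|u_\rho\|_\infty$.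
   Context: Setting: $u_\rho(x)$ is the (homogenized) mean first-passage time, from starting point $x$, of a Brownian particle with space-dependent diffusivity $D(x)$ (Itô interpretation) in $\Omega$ with reflecting boundary, to many small absorbing traps with spatial density $\rho$. The number $\kappa>0$ is the trapping strength, $\kappa=N\nu$ for $N$ traps of radius $\varepsilon$ with $\nu=4\pi\varepsilon$ if $d=3$ and $\nu=2\pi/\log(1/\varepsilon)$ if $d=2$; mathematically it is just a positive parameter. Here $\partial_n$ is the normal derivative on $\partial\Omega$ and $\|\cdot\|_\infty$ is the supremum norm on $\Omega$. *)

theory Defs
  imports "HOL-Analysis.Analysis"
begin

text \<open>Meant for open \<open>S\<close>: there it is the usual class of \<open>k\<close> times continuously differentiable
  functions, since all iterated directional derivatives up to order \<open>k\<close> are continuous.\<close>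

primrec Ck_on :: "nat \<Rightarrow> 'a::euclidean_space set \<Rightarrow> ('a \<Rightarrow> real) \<Rightarrow> bool" where
  "Ck_on 0 S f \<longleftrightarrow> continuous_on S f"
| "Ck_on (Suc k) S f \<longleftrightarrow>
     (\<forall>x\<in>S. f differentiable (at x)) \<and>
     (\<forall>v. Ck_on k S (\<lambda>x. frechet_derivative f (at x) v))"

definition smooth_on :: "'a::euclidean_space set \<Rightarrow> ('a \<Rightarrow> real) \<Rightarrow> bool" where
  "smooth_on S f \<longleftrightarrow> (\<forall>k. Ck_on k S f)"

definition laplacian :: "('a::euclidean_space \<Rightarrow> real) \<Rightarrow> 'a \<Rightarrow> real" where
  "laplacian f x =
     (\<Sum>b\<in>Basis. frechet_derivative (\<lambda>y. frechet_derivative f (at y) b) (at x) b)"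

definition local_defining_function ::
    "'a::euclidean_space set \<Rightarrow> 'a set \<Rightarrow> ('a \<Rightarrow> real) \<Rightarrow> bool" where
  "local_defining_function \<Omega> U g \<longleftrightarrow>
     open U \<and> smooth_on U g \<and> (\<forall>x\<in>U. \<not> (GDERIV g x :> 0)) \<and>
     \<Omega> \<inter> U = {x\<in>U. g x < 0} \<and> frontier \<Omega> \<inter> U = {x\<in>U. g x = 0}"

definition smooth_boundary :: "'a::euclidean_space set \<Rightarrow> bool" where
  "smooth_boundary \<Omega> \<longleftrightarrow>
     (\<forall>p\<in>frontier \<Omega>. \<exists>U g. p \<in> U \<and> local_defining_function \<Omega> U g)"

definition bounded_smooth_domain :: "'a::euclidean_space set \<Rightarrow> bool" where
  "bounded_smooth_domain \<Omega> \<longleftrightarrow>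
     open \<Omega> \<and> connected \<Omega> \<and> \<Omega> \<noteq> {} \<and> bounded \<Omega> \<and> smooth_boundary \<Omega>"

text \<open>The normalised gradient of a defining function (\<^const>\<open>sgn\<close> is \<open>v / |v|\<close>) points out of
  \<open>\<Omega>\<close> and does not depend on the defining function.\<close>

definition outward_unit_normal ::
    "'a::euclidean_space set \<Rightarrow> 'a \<Rightarrow> 'a \<Rightarrow> bool" where
  "outward_unit_normal \<Omega> p n \<longleftrightarrow>
     p \<in> frontier \<Omega> \<and>
     (\<exists>U g v. p \<in> U \<and> local_defining_function \<Omega> U g \<and> (GDERIV g p :> v) \<and> n = sgn v)"

definition trap_density :: "'a::euclidean_space set \<Rightarrow> ('a \<Rightarrow> real) \<Rightarrow> bool" where
  "trap_density \<Omega> \<rho> \<longleftrightarrow> (\<forall>x\<in>\<Omega>. 0 \<le> \<rho> x) \<and> (\<rho> has_integral 1) \<Omega>"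

text \<open>Classical solutions of \<open>\<Delta>u - \<kappa> \<rho> u = -M\<close> in \<open>\<Omega>\<close>, \<open>\<partial>\<^sub>n u = 0\<close> on the boundary, in the class
  \<open>C\<^sup>2(\<Omega>)\<close> and \<open>C\<^sup>1\<close> up to the boundary: \<open>G\<close> is the gradient of \<open>u\<close> together with its continuous
  extension to the boundary, so that \<open>G p \<bullet> n\<close> is the normal derivative at \<open>p\<close>.\<close>

definition neumann_solution ::
    "'a::euclidean_space set \<Rightarrow> ('a \<Rightarrow> real) \<Rightarrow> real \<Rightarrow> ('a \<Rightarrow> real) \<Rightarrow> ('a \<Rightarrow> real) \<Rightarrow> bool" where
  "neumann_solution \<Omega> M \<kappa> \<rho> u \<longleftrightarrow>
     Ck_on 2 \<Omega> u \<and>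
     continuous_on (closure \<Omega>) u \<and>
     (\<forall>x\<in>\<Omega>. laplacian u x - \<kappa> * \<rho> x * u x = - M x) \<and>
     (\<exists>G. continuous_on (closure \<Omega>) G \<and>
          (\<forall>x\<in>\<Omega>. GDERIV u x :> G x) \<and>
          (\<forall>p n. outward_unit_normal \<Omega> p n \<longrightarrow> G p \<bullet> n = 0))"

text \<open>Suprema in \<^typ>\<open>real\<close> are only meaningful for bounded functions; every function to which the
  next two are applied is continuous on the compact closure of \<open>\<Omega>\<close>, where the first is its
  maximum.\<close>

definition worst_case :: "'a::euclidean_space set \<Rightarrow> ('a \<Rightarrow> real) \<Rightarrow> real" where
  "worst_case \<Omega> u = (SUP x\<in>\<Omega>. u x)"

definition sup_norm :: "'a::euclidean_space set \<Rightarrow> ('a \<Rightarrow> real) \<Rightarrow> real" where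
  "sup_norm \<Omega> u = (SUP x\<in>\<Omega>. \<bar>u x\<bar>)"

end

theory Submission
  imports Defs
begin

text \<open>
  Integrating the equation over \<open>\<Omega>\<close>, the Neumann condition kills the Laplacian, so that
  \<open>\<kappa> \<integral> \<rho> u = |M|\<close>: the \<open>\<rho>\<close>-average of every \<open>u\<^sub>\<rho>\<close> is \<open>|M| / \<kappa>\<close>, which is therefore a lower bound of
  its supremum, attained by the constant solution for \<open>\<rho> = \<mu>\<close>. That constant is the only solution
  for \<open>\<mu>\<close>, by testing the equation with \<open>u - |M| / \<kappa>\<close>.

  Both integrations rest on \<open>\<integral> \<psi> div G + \<nabla>\<psi> \<bullet> G = 0\<close> for a field \<open>G\<close> tangential to the boundary, which
  is obtained without surface measure. For \<open>\<psi>\<close> supported near a boundary point, multiply by a cutoff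
  that drops from 1 to 0 in a strip of width of order \<open>\<epsilon>\<close> along the boundary. The gradient of the
  cutoff is of order \<open>1 / \<epsilon>\<close> and the strip has volume of order \<open>\<epsilon>\<close>, while the normal component of \<open>G\<close>
  tends to 0 there by continuity, so the error vanishes as \<open>\<epsilon> \<rightarrow> 0\<close>.
\<close>

section \<open>Calculus and measure estimates\<close>

text \<open>By translation invariance all difference quotients of \<open>f\<close> have integral 0.\<close>

lemma has_integral_directional_derivative_zero:
  fixes f :: "'a::euclidean_space \<Rightarrow> real"
  assumes der: "\<And>x. (f has_derivative f' x) (at x)"
    and cont: "continuous_on UNIV (\<lambda>x. f' x b)"
    and K: "compact K" and zero: "\<And>x. x \<notin> K \<Longrightarrow> f x = 0"
  shows "((\<lambda>x. f' x b) has_integral 0) UNIV"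
proof -
  obtain R where R: "K \<subseteq> cball 0 R"
    using compact_imp_bounded[OF K] by (auto simp: bounded_iff subset_iff)
  define h where "h n = 1 / real (Suc n)" for n
  have h: "0 < h n" "h n \<le> 1" for n by (auto simp: h_def)
  have hlim: "h \<longlonglongrightarrow> 0"
    unfolding h_def by (rule LIMSEQ_Suc[OF lim_1_over_n])
  define q where "q n x = (f (x + h n *\<^sub>R b) - f x) / h n" for n x
  have contf: "continuous_on UNIV f"
    by (intro continuous_at_imp_continuous_on ballI has_derivative_continuous[OF der])
  \<comment> \<open>The radius leaves room twice: a difference quotient is nonzero only within
    \<open>R + norm b\<close>, and the intermediate point of the mean value theorem lies at most
    another \<open>norm b\<close> away because \<open>h n \<le> 1\<close>.\<close>
  obtain B where B: "\<And>x. x \<in> cball 0 (R + 2 * norm b) \<Longrightarrow> \<bar>f' x b\<bar> \<le> B"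
  proof -
    have "compact ((\<lambda>x. f' x b) ` cball 0 (R + 2 * norm b))"
      by (rule compact_continuous_image[OF continuous_on_subset[OF cont]]) auto
    then obtain B where "\<And>y. y \<in> (\<lambda>x. f' x b) ` cball 0 (R + 2 * norm b) \<Longrightarrow> norm y \<le> B"
      using compact_imp_bounded bounded_iff by metis
    then show ?thesis using that by fastforce
  qed
  have line: "((\<lambda>t. f (x + t *\<^sub>R b)) has_real_derivative f' (x + t *\<^sub>R b) b) (at t)" for x t
  proof -
    interpret linear "f' (x + t *\<^sub>R b)" using der has_derivative_linear by blast
    have "((\<lambda>t. f (x + t *\<^sub>R b)) has_derivative (\<lambda>s. f' (x + t *\<^sub>R b) (s *\<^sub>R b))) (at t)"
      by (rule has_derivative_compose[where g = f and f = "\<lambda>t. x + t *\<^sub>R b", OF _ der])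
        (auto intro!: derivative_eq_intros)
    then show ?thesis
      by (simp add: has_field_derivative_def scaleR mult_commute_abs)
  qed
  define K' where "K' = cball (0::'a) (R + norm b)"
  have bound: "norm (q n x) \<le> indicator K' x * B" for n x
  proof (cases "x \<in> K'")
    case True
    have "\<exists>z>0. z < h n \<and> f (x + h n *\<^sub>R b) - f (x + 0 *\<^sub>R b) = (h n - 0) * f' (x + z *\<^sub>R b) b"
      using MVT2[OF h(1)[of n], of "\<lambda>t. f (x + t *\<^sub>R b)" "\<lambda>t. f' (x + t *\<^sub>R b) b"] line by simp
    then obtain z where z: "0 < z" "z < h n"
      "f (x + h n *\<^sub>R b) - f x = h n * f' (x + z *\<^sub>R b) b" by auto
    have "norm (x + z *\<^sub>R b) \<le> norm x + norm (z *\<^sub>R b)" by (rule norm_triangle_ineq)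
    also have "norm (z *\<^sub>R b) \<le> norm b"
      using z h(2)[of n] by (simp add: mult_left_le_one_le)
    finally have "x + z *\<^sub>R b \<in> cball 0 (R + 2 * norm b)" using True by (simp add: K'_def)
    then show ?thesis using True z h(1)[of n] B by (simp add: q_def)
  next
    case False
    have "norm x \<le> norm (x + h n *\<^sub>R b) + norm (h n *\<^sub>R b)"
      using norm_triangle_ineq4[of "x + h n *\<^sub>R b" "h n *\<^sub>R b"] by simp
    also have "norm (h n *\<^sub>R b) \<le> norm b"
      using h[of n] by (simp add: mult_left_le_one_le)
    finally have "x + h n *\<^sub>R b \<notin> cball 0 R" using False by (simp add: K'_def)
    moreover have "x \<notin> cball 0 R" using False norm_ge_zero[of b] unfolding K'_def mem_cball_0 by linarith
    ultimately have "f (x + h n *\<^sub>R b) = 0" "f x = 0" using R zero by blast+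
    then show ?thesis using False by (simp add: q_def)
  qed
  have lim: "(\<lambda>n. q n x) \<longlonglongrightarrow> f' x b" for x
  proof -
    have "((\<lambda>t. (f (x + t *\<^sub>R b) - f x) / t) \<longlongrightarrow> f' x b) (at 0)"
      using line[of x 0] unfolding DERIV_def by simp
    moreover have "filterlim h (at 0) sequentially"
      using hlim h(1) by (auto simp: filterlim_at less_imp_neq[symmetric] intro!: always_eventually)
    ultimately show ?thesis unfolding q_def by (rule filterlim_compose)
  qed
  have meas_f: "f \<in> borel_measurable borel" using contf by (rule borel_measurable_continuous_onI)
  have meas_q: "q n \<in> borel_measurable lborel" for n
    unfolding q_def using meas_f by measurable
  have meas_f': "(\<lambda>x. f' x b) \<in> borel_measurable lborel"
    using borel_measurable_continuous_onI[OF cont] by simp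
  have dom: "integrable lborel (\<lambda>x. indicator K' x * B)"
    unfolding K'_def
    by (intro integrable_mult_left integrable_real_indicator emeasure_bounded_finite) simp_all
  have fint: "integrable lborel f"
  proof -
    have "integrable lborel (\<lambda>x. indicator K x *\<^sub>R f x)"
      using borel_integrable_compact[OF K continuous_on_subset[OF contf]] by simp
    moreover have "(\<lambda>x. indicator K x *\<^sub>R f x) = f"
      using zero by (auto simp: fun_eq_iff indicator_def)
    ultimately show ?thesis by simp
  qed
  have shift: "integrable lborel (\<lambda>x. f (c + x))" "integral\<^sup>L lborel (\<lambda>x. f (c + x)) = integral\<^sup>L lborel f" for c
  proof -
    have m: "(+) c \<in> measurable lborel borel" by simp
    have "integrable (distr lborel borel ((+) c)) f" using fint lborel_distr_plus[of c] by simp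
    then show "integrable lborel (\<lambda>x. f (c + x))"
      using integrable_distr_eq[OF m meas_f] by simp
    show "integral\<^sup>L lborel (\<lambda>x. f (c + x)) = integral\<^sup>L lborel f"
      using integral_distr[OF m meas_f] lborel_distr_plus[of c] by simp
  qed
  have q0: "integral\<^sup>L lborel (q n) = 0" for n
    unfolding q_def using shift[of "h n *\<^sub>R b"] fint
    by (simp add: add.commute)
  have "(\<lambda>n. integral\<^sup>L lborel (q n)) \<longlonglongrightarrow> integral\<^sup>L lborel (\<lambda>x. f' x b)"
    by (rule integral_dominated_convergence[OF meas_f' meas_q dom]) (use lim bound in auto)
  then have "integral\<^sup>L lborel (\<lambda>x. f' x b) = 0"
    by (simp add: q0 LIMSEQ_const_iff)
  moreover have "integrable lborel (\<lambda>x. f' x b)"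
    by (rule integrable_dominated_convergence[where s = q, OF meas_f' meas_q dom]) (use lim bound in auto)
  ultimately show ?thesis using has_integral_integral_lborel[of "\<lambda>x. f' x b"] by simp
qed

text \<open>About \<open>1 / \<epsilon>\<close> translates of the strip along \<open>b\<close> are pairwise disjoint and lie in a fixed ball.\<close>

lemma strip_measure_bound:
  fixes g :: "'a::euclidean_space \<Rightarrow> real"
  assumes c: "c > 0" and cont: "continuous_on (ball p r) g"
    and mono: "\<And>x t. \<lbrakk>x \<in> ball p r; x + t *\<^sub>R b \<in> ball p r; 0 \<le> t\<rbrakk> \<Longrightarrow> c * t \<le> g (x + t *\<^sub>R b) - g x"
  obtains C where "\<And>\<epsilon>. \<lbrakk>0 < \<epsilon>; \<epsilon> \<le> 1\<rbrakk> \<Longrightarrow> measure lebesgue {x \<in> ball p r. - \<epsilon> < g x \<and> g x < 0} \<le> C * \<epsilon>"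
proof -
  \<comment> \<open>Below, \<open>real N * \<epsilon> \<le> 1\<close> keeps every shift
    \<open>a k\<close> within \<open>2 * norm b / c\<close>, so the volume of this ball can serve as
    \<open>C\<close>, uniformly in \<open>\<epsilon>\<close>.\<close>
  define B' where "B' = ball p (r + 2 * norm b / c)"
  have "measure lebesgue {x \<in> ball p r. - \<epsilon> < g x \<and> g x < 0} \<le> measure lebesgue B' * \<epsilon>"
    if \<epsilon>: "0 < \<epsilon>" "\<epsilon> \<le> 1" for \<epsilon>
  proof -
    define S where "S = {x \<in> ball p r. - \<epsilon> < g x \<and> g x < 0}"
    define N where "N = nat \<lfloor>1 / \<epsilon>\<rfloor>"
    \<comment> \<open>Consecutive shifts differ by \<open>2 * \<epsilon> / c\<close> along
      \<open>b\<close>, over which \<open>g\<close> grows by at least \<open>2 * \<epsilon>\<close>.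
      On \<open>S\<close> it varies by less than \<open>\<epsilon>\<close>, so distinct translates
      cannot meet.\<close>
    define a where "a k = (real k * (2 * \<epsilon> / c)) *\<^sub>R b" for k :: nat
    have N: "real N \<le> 1 / \<epsilon>" "1 / \<epsilon> \<le> real (Suc N)" 
      using \<epsilon> of_int_floor_le[of "1 / \<epsilon>"] real_of_int_floor_add_one_gt[of "1 / \<epsilon>"]
      by (simp_all add: N_def less_imp_le add.commute)
    have "S = ball p r \<inter> g -` {- \<epsilon><..<0}" by (auto simp: S_def)
    then have "open S" using continuous_open_preimage[OF cont open_ball open_greaterThanLessThan] by simp
    then have S: "S \<in> lmeasurable" 
      by (intro lmeasurable_open bounded_subset[OF bounded_ball[of p r]]) (auto simp: S_def)
    have T: "(+) (a k) ` S \<in> lmeasurable" for k using S by (rule measurable_translation)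
    have disj: "disjoint_family_on (\<lambda>k. (+) (a k) ` S) {..N}"
    proof -
      have False if "j < k" "x \<in> S" "y \<in> S" "a k + x = a j + y" for j k x y
      proof -
        define t where "t = real (k - j) * (2 * \<epsilon> / c)"
        have "y = x + (a k - a j)" using that(4) by (simp add: algebra_simps)
        also have "a k - a j = t *\<^sub>R b"
          using that(1) by (simp add: a_def t_def of_nat_diff left_diff_distrib diff_divide_distrib flip: scaleR_left_diff_distrib)
        finally have y: "y = x + t *\<^sub>R b" .
        have "1 * (2 * \<epsilon> / c) \<le> t" unfolding t_def
          by (rule mult_right_mono) (use that(1) \<epsilon> c in auto)
        then have t: "2 * \<epsilon> \<le> c * t" using c by (simp add: field_simps)
        have "0 \<le> t" using c \<epsilon> by (simp add: t_def)
        have "c * t \<le> g y - g x" using mono[of x t] that \<open>0 \<le> t\<close> y by (auto simp: S_def)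
        then show False using t that(2,3) \<epsilon> by (auto simp: S_def)
      qed
      then have "a k + x \<noteq> a j + y" if "k \<noteq> j" "x \<in> S" "y \<in> S" for j k x y
        using that by (metis neq_iff)
      then show ?thesis unfolding disjoint_family_on_def by blast
    qed
    have sub: "(\<Union>k\<le>N. (+) (a k) ` S) \<subseteq> B'"
    proof clarsimp
      fix k x assume k: "k \<le> N" and x: "x \<in> S"
      have "real k * \<epsilon> \<le> real N * \<epsilon>" using k \<epsilon> by (intro mult_right_mono) auto
      also have "\<dots> \<le> 1" using N(1) \<epsilon> by (simp add: field_simps)
      finally have "real k * (2 * \<epsilon> / c) * norm b \<le> 2 * norm b / c"
        using c mult_right_mono[of "real k * \<epsilon>" 1 "2 * norm b / c"] by (simp add: field_simps)
      then have "norm (a k) \<le> 2 * norm b / c" using \<epsilon> c by (simp add: a_def)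
      moreover have "dist p (a k + x) \<le> dist p x + norm (a k)"
        by (metis add.commute dist_norm norm_triangle_ineq4 diff_diff_add)
      ultimately show "a k + x \<in> B'" using x by (auto simp: S_def B'_def)
    qed
    have "real (Suc N) * measure lebesgue S = (\<Sum>k\<le>N. measure lebesgue ((+) (a k) ` S))"
      by (simp add: measure_translation)
    also have "\<dots> = measure lebesgue (\<Union>k\<le>N. (+) (a k) ` S)"
      by (rule measure_finite_Union[symmetric])
        (use fmeasurableD[OF T] fmeasurableD2[OF T] disj in auto)
    also have "\<dots> \<le> measure lebesgue B'"
      by (rule measure_mono_fmeasurable[OF sub]) (use fmeasurableD[OF T] in \<open>auto simp: B'_def\<close>)
    finally have le: "real (Suc N) * measure lebesgue S \<le> measure lebesgue B'" .
    have "1 / \<epsilon> * measure lebesgue S \<le> real (Suc N) * measure lebesgue S"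
      by (rule mult_right_mono[OF N(2)]) simp
    then have "1 / \<epsilon> * measure lebesgue S \<le> measure lebesgue B'" using le by linarith
    then show ?thesis using \<epsilon> unfolding S_def by (simp add: field_simps)
  qed
  then show ?thesis by (rule that)
qed

section \<open>Integrability criteria and gradients\<close>

lemma absolutely_integrable_bounded_continuous:
  fixes f :: "'a::euclidean_space \<Rightarrow> real"
  assumes "open S" "bounded S" "continuous_on S f" and B: "\<And>x. x \<in> S \<Longrightarrow> \<bar>f x\<bar> \<le> B"
  shows "f absolutely_integrable_on S"
proof (rule measurable_bounded_by_integrable_imp_absolutely_integrable)
  show "f \<in> borel_measurable (lebesgue_on S)"
    using assms by (intro continuous_imp_measurable_on_sets_lebesgue) auto
  show "(\<lambda>x. B) integrable_on S"
    using assms by (intro integrable_on_const lmeasurable_open)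
qed (use assms in auto)

lemma absolutely_integrable_continuous_mult:
  fixes f g :: "'a::euclidean_space \<Rightarrow> real"
  assumes "open S" "continuous_on S f" "bounded (f ` S)" "g absolutely_integrable_on S"
  shows "(\<lambda>x. f x * g x) absolutely_integrable_on S"
  using assms
  by (intro absolutely_integrable_bounded_measurable_product[OF bilinear_times]
      continuous_imp_measurable_on_sets_lebesgue) auto

lemma GDERIV_continuous_on:
  "(\<And>x. x \<in> S \<Longrightarrow> GDERIV f x :> P x) \<Longrightarrow> continuous_on S f"
  by (meson continuous_at_imp_continuous_on gderiv_def has_derivative_continuous)

lemma GDERIV_cong_open:
  assumes "GDERIV f x :> d" "open S" "x \<in> S" "\<And>y. y \<in> S \<Longrightarrow> f y = g y"
  shows "GDERIV g x :> d"
  using has_derivative_transform_within_open[of f "\<lambda>h. h \<bullet> d" x UNIV S g] assms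
  by (simp add: gderiv_def)

lemma GDERIV_unique:
  assumes "GDERIV f x :> d" "GDERIV f x :> e"
  shows "d = e"
proof -
  have "(\<lambda>h. h \<bullet> d) = (\<lambda>h. h \<bullet> e)"
    using assms has_derivative_unique unfolding gderiv_def by blast
  then show ?thesis by (metis inner_commute vector_eq_ldot)
qed

text \<open>The antiderivative of the hat function \<open>smoothstep'\<close>, which is supported on
  [0, 2] with peak 1 at 1. Truncated powers make it a quadratic spline whose derivative needs only
  that of \<open>(max 0 t)\<^sup>2\<close>.\<close>

definition smoothstep :: "real \<Rightarrow> real" where
  "smoothstep t = ((max 0 t)\<^sup>2 - 2 * (max 0 (t - 1))\<^sup>2 + (max 0 (t - 2))\<^sup>2) / 2"

definition smoothstep' :: "real \<Rightarrow> real" where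
  "smoothstep' t = max 0 t - 2 * max 0 (t - 1) + max 0 (t - 2)"

lemma DERIV_max_0_square: "((\<lambda>t::real. (max 0 t)\<^sup>2) has_real_derivative 2 * max 0 t) (at t)"
proof -
  consider "t < 0" | "t > 0" | "t = 0" by linarith
  then show ?thesis
  proof cases
    case 1
    then have "((\<lambda>t. 0) has_real_derivative 2 * max 0 t) (at t)" by simp
    then show ?thesis
      by (rule has_field_derivative_transform_within_open[of _ _ _ "{..<0}"]) (use 1 in auto)
  next
    case 2
    then have "((\<lambda>t. t\<^sup>2) has_real_derivative 2 * max 0 t) (at t)"
      by (auto intro!: derivative_eq_intros)
    then show ?thesis
      by (rule has_field_derivative_transform_within_open[of _ _ _ "{0<..}"]) (use 2 in auto)
  next
    case 3
    have "((\<lambda>h. (max 0 h)\<^sup>2 / h) \<longlongrightarrow> 0) (at (0::real))"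
    proof (rule Lim_null_comparison)
      show "\<forall>\<^sub>F h in at (0::real). norm ((max 0 h)\<^sup>2 / h) \<le> \<bar>h\<bar>"
        by (rule always_eventually) (auto simp: max_def power2_eq_square)
      show "((\<lambda>h. \<bar>h\<bar>) \<longlongrightarrow> 0) (at (0::real))"
        by (rule tendsto_rabs_zero) (rule tendsto_ident_at)
    qed
    then show ?thesis using 3 by (simp add: DERIV_def)
  qed
qed

lemma DERIV_smoothstep: "(smoothstep has_real_derivative smoothstep' t) (at t)"
proof -
  have *: "((\<lambda>t. (max 0 (t - a))\<^sup>2) has_real_derivative 2 * max 0 (t - a)) (at t)" for a
    using DERIV_shift[of "\<lambda>t. (max 0 t)\<^sup>2" "2 * max 0 (t - a)" t "- a"] DERIV_max_0_square[of "t - a"]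
    by simp
  show ?thesis
    unfolding smoothstep_def[abs_def] smoothstep'_def
    by (rule derivative_eq_intros DERIV_max_0_square * | simp)+
qed

lemma smoothstep_eq_0: "t \<le> 0 \<Longrightarrow> smoothstep t = 0"
  and smoothstep_eq_1: "2 \<le> t \<Longrightarrow> smoothstep t = 1"
  and smoothstep'_eq_0: "t \<le> 0 \<or> 2 \<le> t \<Longrightarrow> smoothstep' t = 0"
  and smoothstep'_bounds: "\<bar>smoothstep' t\<bar> \<le> 1"
  by (auto simp: smoothstep_def smoothstep'_def max_def power2_eq_square algebra_simps)

lemma smoothstep_bounds: "0 \<le> smoothstep t" "smoothstep t \<le> 1"
proof -
  have nonneg: "0 \<le> smoothstep' t" for t by (simp add: smoothstep'_def max_def)
  have mono: "smoothstep a \<le> smoothstep b" if "a \<le> b" for a b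
    using that DERIV_nonneg_imp_nondecreasing DERIV_smoothstep nonneg by blast
  show "0 \<le> smoothstep t" "smoothstep t \<le> 1"
    using mono[of "min 0 t" t] mono[of t "max 2 t"] smoothstep_eq_0[of "min 0 t"] smoothstep_eq_1[of "max 2 t"]
    by auto
qed

lemma continuous_on_smoothstep': "continuous_on S smoothstep'"
  unfolding smoothstep'_def[abs_def] by (intro continuous_intros)

lemma continuous_on_smoothstep: "continuous_on S smoothstep"
  using DERIV_smoothstep DERIV_isCont continuous_at_imp_continuous_on by blast

lemma GDERIV_smoothstep:
  "GDERIV f x :> d \<Longrightarrow> GDERIV (\<lambda>x. smoothstep (f x)) x :> smoothstep' (f x) *\<^sub>R d"
  by (rule GDERIV_DERIV_compose[OF _ DERIV_smoothstep])

text \<open>The step profile is applied to an affine function of the squared distance to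
  \<open>p\<close>, which, unlike the distance, is differentiable at the centre too.\<close>

lemma C1_bump:
  fixes p :: "'a::euclidean_space"
  assumes "r > 0"
  obtains h Q where "\<And>x. GDERIV h x :> Q x" "continuous_on UNIV Q"
    "\<And>x. x \<in> ball p (r / 2) \<Longrightarrow> h x = (1::real)" "\<And>x. x \<notin> ball p r \<Longrightarrow> h x = 0"
proof -
  \<comment> \<open>Normalised so that \<open>k * (r\<^sup>2 - (r / 2)\<^sup>2) = 2\<close>: the
    profile has reached 1 at distance \<open>r / 2\<close> and has dropped to 0 at distance
    \<open>r\<close>.\<close>
  define k where "k = 8 / (3 * r\<^sup>2)"
  define h where "h x = smoothstep (k * (r\<^sup>2 - (x - p) \<bullet> (x - p)))" for x
  define Q where "Q x = smoothstep' (k * (r\<^sup>2 - (x - p) \<bullet> (x - p))) *\<^sub>R (- (2 * k) *\<^sub>R (x - p))" for x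
  have k: "k > 0" using assms by (simp add: k_def)
  have sq: "(x - p) \<bullet> (x - p) = (dist p x)\<^sup>2" for x
    by (metis dist_commute dist_norm power2_norm_eq_inner)
  show ?thesis
  proof
    show "GDERIV h x :> Q x" for x
      unfolding h_def Q_def
      by (rule GDERIV_smoothstep)
        (auto simp: gderiv_def fun_eq_iff inner_commute algebra_simps intro!: derivative_eq_intros)
    show "continuous_on UNIV Q"
      unfolding Q_def
      by (intro continuous_intros continuous_on_compose2[OF continuous_on_smoothstep'[of UNIV]]) auto
    show "h x = 1" if "x \<in> ball p (r / 2)" for x
    proof -
      have "(dist p x)\<^sup>2 \<le> (r / 2)\<^sup>2" using that by (intro power_mono) auto
      then have "k * (3 / 4 * r\<^sup>2) \<le> k * (r\<^sup>2 - (dist p x)\<^sup>2)"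
        using k by (intro mult_left_mono) (auto simp: power_divide)
      moreover have "k * (3 / 4 * r\<^sup>2) = 2" using assms by (simp add: k_def)
      ultimately show ?thesis unfolding h_def sq by (intro smoothstep_eq_1) simp
    qed
    show "h x = 0" if "x \<notin> ball p r" for x
    proof -
      have "r\<^sup>2 \<le> (dist p x)\<^sup>2" using that assms by (intro power_mono) auto
      then show ?thesis using k unfolding h_def sq
        by (intro smoothstep_eq_0) (simp add: mult_le_0_iff)
    qed
  qed
qed

lemma differentiable_imp_GDERIV:
  fixes f :: "'a::euclidean_space \<Rightarrow> real"
  assumes "f differentiable (at x)"
  shows "GDERIV f x :> (\<Sum>b\<in>Basis. frechet_derivative f (at x) b *\<^sub>R b)"
proof -
  have D: "(f has_derivative frechet_derivative f (at x)) (at x)"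
    using assms frechet_derivative_works by blast
  interpret linear "frechet_derivative f (at x)" using D has_derivative_linear by blast
  have "frechet_derivative f (at x) h = h \<bullet> (\<Sum>b\<in>Basis. frechet_derivative f (at x) b *\<^sub>R b)" for h
  proof -
    have "frechet_derivative f (at x) h = frechet_derivative f (at x) (\<Sum>b\<in>Basis. (h \<bullet> b) *\<^sub>R b)"
      by (simp add: euclidean_representation)
    also have "\<dots> = (\<Sum>b\<in>Basis. (h \<bullet> b) * frechet_derivative f (at x) b)"
      by (simp add: sum scale)
    finally show ?thesis by (simp add: inner_sum_right mult.commute)
  qed
  then have "frechet_derivative f (at x) = (\<lambda>h. h \<bullet> (\<Sum>b\<in>Basis. frechet_derivative f (at x) b *\<^sub>R b))"
    by blast
  then show ?thesis unfolding gderiv_def using D by metis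
qed

lemma smooth_on_gradient:
  fixes g :: "'a::euclidean_space \<Rightarrow> real"
  assumes "smooth_on U g"
  obtains N where "\<And>x. x \<in> U \<Longrightarrow> GDERIV g x :> N x" "continuous_on U N"
proof
  have "Ck_on 1 U g" using assms by (simp add: smooth_on_def)
  then have *: "\<And>x. x \<in> U \<Longrightarrow> g differentiable (at x)"
    "\<And>v. continuous_on U (\<lambda>x. frechet_derivative g (at x) v)" by auto
  show "x \<in> U \<Longrightarrow> GDERIV g x :> (\<Sum>b\<in>Basis. frechet_derivative g (at x) b *\<^sub>R b)" for x
    using *(1) by (rule differentiable_imp_GDERIV)
  show "continuous_on U (\<lambda>x. \<Sum>b\<in>Basis. frechet_derivative g (at x) b *\<^sub>R b)"
    by (intro continuous_intros *)
qed

text \<open>By continuity the derivative of \<open>g\<close> in the fixed direction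
  \<open>N p\<close> stays above half of its value at \<open>p\<close> in a small ball, which yields
  the linear growth required by \<open>strip_measure_bound\<close>.\<close>

lemma strip_measure_bound_gradient:
  fixes g :: "'a::euclidean_space \<Rightarrow> real"
  assumes U: "open U" "p \<in> U" and g: "\<And>x. x \<in> U \<Longrightarrow> GDERIV g x :> N x" "continuous_on U N"
    and N: "N p \<noteq> 0"
  obtains r C where "r > 0" "cball p r \<subseteq> U"
    "\<And>\<epsilon>. \<lbrakk>0 < \<epsilon>; \<epsilon> \<le> 1\<rbrakk> \<Longrightarrow> measure lebesgue {x \<in> ball p r. - \<epsilon> < g x \<and> g x < 0} \<le> C * \<epsilon>"
proof -
  define v where "v = N p"
  define c where "c = (v \<bullet> v) / 2"
  have v: "0 < v \<bullet> v" using N by (simp add: v_def)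
  have c: "0 < c" "c < v \<bullet> v" using v by (simp_all add: c_def)
  define V where "V = U \<inter> (\<lambda>x. N x \<bullet> v) -` {c<..}"
  have "open V"
    unfolding V_def using g(2) U(1) by (intro continuous_open_preimage continuous_intros) auto
  moreover have "p \<in> V" using U c by (simp add: V_def v_def)
  ultimately obtain r where r: "r > 0" "cball p r \<subseteq> V" using open_contains_cball by blast
  have "continuous_on (ball p r) g"
    using r(2) ball_subset_cball by (intro GDERIV_continuous_on[of _ g N] g(1)) (auto simp: V_def)
  moreover have "c * t \<le> g (x + t *\<^sub>R v) - g x"
    if x: "x \<in> ball p r" "x + t *\<^sub>R v \<in> ball p r" and t: "0 \<le> t" for x t
  proof (cases "t = 0")
    case False
    then have t: "0 < t" using t by simp
    \<comment> \<open>Convexity of the ball keeps the intermediate points of the mean value theorem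
      where the gradient bound holds.\<close>
    have seg: "x + z *\<^sub>R v \<in> ball p r" if "0 \<le> z" "z \<le> t" for z
    proof -
      have "x + z *\<^sub>R v = (1 - z / t) *\<^sub>R x + (z / t) *\<^sub>R (x + t *\<^sub>R v)"
        using t by (simp add: algebra_simps)
      also have "\<dots> \<in> ball p r"
        using x t that by (intro convexD[OF convex_ball]) auto
      finally show ?thesis .
    qed
    have "((\<lambda>z. g (x + z *\<^sub>R v)) has_real_derivative N (x + z *\<^sub>R v) \<bullet> v) (at z)"
      if "0 \<le> z" "z \<le> t" for z
    proof -
      have "GDERIV g (x + z *\<^sub>R v) :> N (x + z *\<^sub>R v)"
        using seg[OF that] r(2) ball_subset_cball by (intro g(1)) (auto simp: V_def)
      then have "((\<lambda>z. g (x + z *\<^sub>R v)) has_derivative (\<lambda>h. (h *\<^sub>R v) \<bullet> N (x + z *\<^sub>R v))) (at z)"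
        unfolding gderiv_def
        by (intro has_derivative_compose[where g = g and f = "\<lambda>z. x + z *\<^sub>R v"])
          (auto intro!: derivative_eq_intros)
      then show ?thesis
        by (simp add: has_field_derivative_def mult_commute_abs inner_commute)
    qed
    from MVT2[OF t, of "\<lambda>z. g (x + z *\<^sub>R v)", OF this]
    obtain z where z: "0 < z" "z < t" "g (x + t *\<^sub>R v) - g x = t * (N (x + z *\<^sub>R v) \<bullet> v)"
      by auto
    have "x + z *\<^sub>R v \<in> V" using seg[of z] z r(2) ball_subset_cball by auto
    then have "c \<le> N (x + z *\<^sub>R v) \<bullet> v" by (simp add: V_def)
    then show ?thesis using z(3) t by (simp add: mult.commute)
  qed simp
  ultimately obtain C where
    "\<And>\<epsilon>. \<lbrakk>0 < \<epsilon>; \<epsilon> \<le> 1\<rbrakk> \<Longrightarrow> measure lebesgue {x \<in> ball p r. - \<epsilon> < g x \<and> g x < 0} \<le> C * \<epsilon>"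
    using strip_measure_bound[OF c(1)] by blast
  then show ?thesis using r that by (auto simp: V_def)
qed

section \<open>The divergence theorem for tangential fields\<close>

text \<open>\<open>D b x\<close> is the derivative at \<open>x\<close> of the component of \<open>G\<close> along \<open>b\<close>, so that \<open>\<Sum>b\<in>Basis. D b x b\<close> is the
  divergence of \<open>G\<close>.\<close>

locale tangential_field =
  fixes \<Omega> :: "'a::euclidean_space set" and G :: "'a \<Rightarrow> 'a" and D :: "'a \<Rightarrow> 'a \<Rightarrow> 'a \<Rightarrow> real"
  assumes open_domain: "open \<Omega>" and bounded_domain: "bounded \<Omega>"
    and boundary: "smooth_boundary \<Omega>"
    and deriv: "\<lbrakk>b \<in> Basis; x \<in> \<Omega>\<rbrakk> \<Longrightarrow> ((\<lambda>y. G y \<bullet> b) has_derivative D b x) (at x)"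
    and cont_deriv: "b \<in> Basis \<Longrightarrow> continuous_on \<Omega> (\<lambda>x. D b x b)"
    and cont_field: "continuous_on (closure \<Omega>) G"
    and tangential: "outward_unit_normal \<Omega> p n \<Longrightarrow> G p \<bullet> n = 0"
    and div_integrable: "(\<lambda>x. \<Sum>b\<in>Basis. D b x b) absolutely_integrable_on \<Omega>"
begin

definition dvg :: "'a \<Rightarrow> real" where
  "dvg x = (\<Sum>b\<in>Basis. D b x b)"

text \<open>No continuity up to the boundary is asked of \<open>\<psi>\<close> or \<open>P\<close>:
  boundedness is enough for the flux integral to exist, and it is preserved under products.\<close>

definition test_fun :: "('a \<Rightarrow> real) \<Rightarrow> ('a \<Rightarrow> 'a) \<Rightarrow> bool" where
  "test_fun \<psi> P \<longleftrightarrow> (\<forall>x\<in>\<Omega>. GDERIV \<psi> x :> P x) \<and> continuous_on \<Omega> P \<and>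
     bounded (\<psi> ` \<Omega>) \<and> bounded (P ` \<Omega>)"

text \<open>For \<open>P\<close> the gradient of \<open>\<psi>\<close> the integrand is the
  divergence of the field \<open>\<psi> G\<close>, so this volume integral stands for the flux of
  that field through the boundary.\<close>

definition flux :: "('a \<Rightarrow> real) \<Rightarrow> ('a \<Rightarrow> 'a) \<Rightarrow> real" where
  "flux \<psi> P = integral \<Omega> (\<lambda>x. \<psi> x * dvg x + P x \<bullet> G x)"

section \<open>Bounded test functions and the flux integral\<close>

lemma compact_closure_domain: "compact (closure \<Omega>)"
  using bounded_domain by simp

lemma cont_field': "continuous_on \<Omega> G"
  using cont_field closure_subset continuous_on_subset by blast

lemma field_bound: obtains B where "B > 0" "\<And>x. x \<in> closure \<Omega> \<Longrightarrow> norm (G x) \<le> B"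
proof -
  have "bounded (G ` closure \<Omega>)"
    using compact_continuous_image[OF cont_field compact_closure_domain] compact_imp_bounded by blast
  then show ?thesis using that unfolding bounded_pos by auto
qed

lemma test_funD:
  assumes "test_fun \<psi> P"
  shows "x \<in> \<Omega> \<Longrightarrow> GDERIV \<psi> x :> P x" "continuous_on \<Omega> P" "continuous_on \<Omega> \<psi>"
    "bounded (\<psi> ` \<Omega>)" "bounded (P ` \<Omega>)"
  using assms GDERIV_continuous_on[of \<Omega> \<psi> P] by (auto simp: test_fun_def)

lemma flux_integrable:
  assumes "test_fun \<psi> P"
  shows "(\<lambda>x. \<psi> x * dvg x + P x \<bullet> G x) absolutely_integrable_on \<Omega>"
proof (rule set_integral_add(1))
  note T = test_funD[OF assms]
  show "(\<lambda>x. \<psi> x * dvg x) absolutely_integrable_on \<Omega>"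
    unfolding dvg_def using T div_integrable open_domain
    by (intro absolutely_integrable_continuous_mult)
  obtain B where B: "\<And>x. x \<in> closure \<Omega> \<Longrightarrow> norm (G x) \<le> B" using field_bound by blast
  obtain C where C: "\<And>x. x \<in> \<Omega> \<Longrightarrow> norm (P x) \<le> C" using T(5) by (auto simp: bounded_iff)
  show "(\<lambda>x. P x \<bullet> G x) absolutely_integrable_on \<Omega>"
  proof (rule absolutely_integrable_bounded_continuous[OF open_domain bounded_domain])
    show "continuous_on \<Omega> (\<lambda>x. P x \<bullet> G x)" using T cont_field' by (intro continuous_intros)
    show "\<bar>P x \<bullet> G x\<bar> \<le> C * B" if "x \<in> \<Omega>" for x
    proof -
      have "\<bar>P x \<bullet> G x\<bar> \<le> norm (P x) * norm (G x)" by (rule Cauchy_Schwarz_ineq2)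
      also have "\<dots> \<le> C * B"
        using B[of x] C[of x] that closure_subset norm_ge_zero[of "P x"]
        by (intro mult_mono) (auto intro: order_trans[OF norm_ge_zero])
      finally show ?thesis .
    qed
  qed
qed

lemma test_fun_mult:
  assumes "test_fun \<psi> P" "test_fun \<eta> Q"
  shows "test_fun (\<lambda>x. \<psi> x * \<eta> x) (\<lambda>x. \<psi> x *\<^sub>R Q x + \<eta> x *\<^sub>R P x)"
proof -
  note T = test_funD[OF assms(1)] and S = test_funD[OF assms(2)]
  have bnd: "bounded ((\<lambda>x. f x *\<^sub>R g x) ` \<Omega>)"
    if fb: "bounded (f ` \<Omega>)" and gb: "bounded (g ` \<Omega>)" for f :: "'a \<Rightarrow> real" and g :: "'a \<Rightarrow> 'b::real_normed_vector"
  proof -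
    obtain B where "\<And>x. x \<in> \<Omega> \<Longrightarrow> norm (f x) \<le> B" using fb by (auto simp: bounded_iff)
    moreover obtain C where "\<And>x. x \<in> \<Omega> \<Longrightarrow> norm (g x) \<le> C" using gb by (auto simp: bounded_iff)
    ultimately have "norm (f x *\<^sub>R g x) \<le> B * C" if "x \<in> \<Omega>" for x
      unfolding norm_scaleR using that
      by (intro mult_mono) (auto intro: order_trans[OF norm_ge_zero] order_trans[OF abs_ge_zero])
    then show ?thesis by (auto simp: bounded_iff)
  qed
  show ?thesis
    unfolding test_fun_def
    using T S bnd[of \<psi> \<eta>] bnd[of \<psi> Q] bnd[of \<eta> P]
    by (auto intro!: GDERIV_mult continuous_intros bounded_plus_comp)
qed

lemma test_fun_diff:
  assumes "test_fun \<psi> P" "test_fun \<eta> Q"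
  shows "test_fun (\<lambda>x. \<psi> x - \<eta> x) (\<lambda>x. P x - Q x)"
  using test_funD[OF assms(1)] test_funD[OF assms(2)] unfolding test_fun_def
  by (auto intro!: GDERIV_diff continuous_intros bounded_minus_comp)

lemma flux_diff:
  assumes "test_fun \<psi> P" "test_fun \<eta> Q"
  shows "flux (\<lambda>x. \<psi> x - \<eta> x) (\<lambda>x. P x - Q x) = flux \<psi> P - flux \<eta> Q"
  unfolding flux_def
  using integral_diff[OF flux_integrable[OF assms(1), THEN set_lebesgue_integral_eq_integral(1)]
      flux_integrable[OF assms(2), THEN set_lebesgue_integral_eq_integral(1)]]
  by (simp add: algebra_simps)

lemma test_fun_C1:
  assumes "\<And>x. GDERIV h x :> Q x" "continuous_on UNIV Q"
  shows "test_fun h Q"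
proof -
  have b: "bounded (f ` \<Omega>)" if "continuous_on UNIV f" for f :: "'a \<Rightarrow> 'b::metric_space"
    using compact_continuous_image[OF continuous_on_subset[OF that] compact_closure_domain]
    by (meson bounded_subset closure_subset compact_imp_bounded image_mono subset_UNIV)
  show ?thesis
    unfolding test_fun_def
    using assms b[OF assms(2)] b[OF GDERIV_continuous_on[of UNIV h Q]] continuous_on_subset[OF assms(2)] by auto
qed

text \<open>Extended by 0, each \<open>\<psi> x * (G x \<bullet> b)\<close> becomes a compactly
  supported function on the whole space, and its derivative along \<open>b\<close> integrates to 0.
  Summing over the basis gives the divergence of \<open>\<psi> G\<close>.\<close>

lemma flux_compact_support:
  assumes test: "test_fun \<psi> P" and K: "compact K" "K \<subseteq> \<Omega>" and supp: "\<And>x. x \<in> \<Omega> - K \<Longrightarrow> \<psi> x = 0"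
  shows "flux \<psi> P = 0"
proof -
  note T = test_funD[OF test]
  define f where "f b x = (if x \<in> \<Omega> then \<psi> x * (G x \<bullet> b) else 0)" for b x
  define f' where "f' b x = (if x \<in> \<Omega> then (\<lambda>h. \<psi> x * D b x h + (h \<bullet> P x) * (G x \<bullet> b)) else (\<lambda>_. 0))" for b x
  have opK: "open (- K)" using K(1) by (simp add: compact_imp_closed open_Compl)
  have out: "(f b has_derivative (\<lambda>_. 0)) (at x)" if "x \<notin> K" for b x
  proof (rule has_derivative_transform_within_open)
    show "((\<lambda>_. 0) has_derivative (\<lambda>_. 0)) (at x)" by simp
    show "0 = f b y" if "y \<in> - K" for y using that supp by (simp add: f_def)
  qed (use opK that in auto)
  have inn: "(f b has_derivative f' b x) (at x)" if "x \<in> \<Omega>" "b \<in> Basis" for b x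
  proof (rule has_derivative_transform_within_open[OF _ open_domain that(1)])
    show "((\<lambda>y. \<psi> y * (G y \<bullet> b)) has_derivative f' b x) (at x)"
      using has_derivative_mult[OF T(1)[OF that(1), unfolded gderiv_def] deriv[OF that(2,1)]] that
      by (simp add: f'_def)
  qed (simp add: f_def)
  have der: "(f b has_derivative f' b x) (at x)" if "b \<in> Basis" for b x
    using inn[of x b] out[of x b] K(2) that by (cases "x \<in> \<Omega>") (auto simp: f'_def)
  have int: "((\<lambda>x. f' b x b) has_integral 0) UNIV" if b: "b \<in> Basis" for b
  proof (rule has_integral_directional_derivative_zero[OF der[OF b] _ K(1)])
    have "continuous_on \<Omega> (\<lambda>x. \<psi> x * D b x b + (b \<bullet> P x) * (G x \<bullet> b))"
      using T cont_field' cont_deriv[OF b] by (intro continuous_intros)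
    then have "continuous_on \<Omega> (\<lambda>x. f' b x b)" by (simp add: f'_def cong: continuous_on_cong)
    \<comment> \<open>On the overlap of \<open>\<Omega>\<close> with the complement of
      \<open>K\<close>, \<open>f'\<close> is given by the product formula. Uniqueness of the
      derivative shows that it vanishes there, so continuity can be glued from the two open
      sets.\<close>
    moreover have "f' b x = (\<lambda>_. 0)" if "x \<in> - K" for x
      using has_derivative_unique[OF der[OF b] out] that by simp
    then have "continuous_on (- K) (\<lambda>x. f' b x b)" by (intro continuous_on_eq[OF continuous_on_const[of _ 0]]) simp
    ultimately have "continuous_on (\<Omega> \<union> - K) (\<lambda>x. f' b x b)"
      using open_domain opK by (intro continuous_on_open_Un) auto
    moreover have "\<Omega> \<union> - K = UNIV" using K(2) by auto
    ultimately show "continuous_on UNIV (\<lambda>x. f' b x b)" by simp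
    show "f b x = 0" if "x \<notin> K" for x using supp that by (simp add: f_def)
  qed
  have "((\<lambda>x. \<Sum>b\<in>Basis. f' b x b) has_integral (\<Sum>b\<in>(Basis::'a set). 0)) UNIV"
    using int by (intro has_integral_sum) auto
  moreover have "(\<Sum>b\<in>Basis. f' b x b) = (if x \<in> \<Omega> then \<psi> x * dvg x + P x \<bullet> G x else 0)" for x
  proof -
    have "P x \<bullet> G x = (\<Sum>b\<in>Basis. (b \<bullet> P x) * (G x \<bullet> b))"
      by (subst euclidean_inner) (simp add: inner_commute)
    then show ?thesis by (simp add: f'_def dvg_def sum.distrib sum_distrib_left)
  qed
  ultimately have "((\<lambda>x. \<psi> x * dvg x + P x \<bullet> G x) has_integral 0) \<Omega>"
    by (simp add: has_integral_restrict_UNIV)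
  then show ?thesis unfolding flux_def by (rule integral_unique)
qed

text \<open>Instead of a partition of unity: multiplying \<open>\<psi>\<close> successively by \<open>1 - h\<close> for bumps \<open>h\<close> that are 1
  on the balls of a finite cover leaves the flux unchanged and ends with 0.\<close>

lemma flux_eq_0_if_local:
  assumes loc: "\<And>p. p \<in> closure \<Omega> \<Longrightarrow>
      \<exists>r>0. \<forall>\<psi> P. test_fun \<psi> P \<longrightarrow> (\<forall>x\<in>\<Omega> - ball p r. \<psi> x = 0) \<longrightarrow> flux \<psi> P = 0"
    and test: "test_fun \<psi> P"
  shows "flux \<psi> P = 0"
proof -
  obtain r where r: "\<And>p. p \<in> closure \<Omega> \<Longrightarrow> r p > 0"
    "\<And>p \<psi> P. \<lbrakk>p \<in> closure \<Omega>; test_fun \<psi> P; \<forall>x\<in>\<Omega> - ball p (r p). \<psi> x = 0\<rbrakk> \<Longrightarrow> flux \<psi> P = 0"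
    using bchoice[of "closure \<Omega>" "\<lambda>p r. r > 0 \<and> (\<forall>\<psi> P. test_fun \<psi> P \<longrightarrow> (\<forall>x\<in>\<Omega> - ball p r. \<psi> x = 0) \<longrightarrow> flux \<psi> P = 0)"]
      loc by blast
  have cover: "closure \<Omega> \<subseteq> (\<Union>p\<in>closure \<Omega>. ball p (r p / 2))" using r(1) by force
  obtain F where F: "F \<subseteq> closure \<Omega>" "finite F" "closure \<Omega> \<subseteq> (\<Union>p\<in>F. ball p (r p / 2))"
    by (rule compactE_image[OF compact_closure_domain _ cover]) auto
  have "flux \<psi> P = 0" if "test_fun \<psi> P" "\<forall>x\<in>\<Omega> - (\<Union>p\<in>F. ball p (r p / 2)). \<psi> x = 0" for \<psi> P
    using F(2,1) that
  proof (induction F arbitrary: \<psi> P rule: finite_induct)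
    case empty
    then show ?case using flux_compact_support[of \<psi> P "{}"] by simp
  next
    case (insert p F)
    have p: "p \<in> closure \<Omega>" using insert.prems by simp
    obtain h Q where h: "\<And>x. GDERIV h x :> Q x" "continuous_on UNIV Q"
      "\<And>x. x \<in> ball p (r p / 2) \<Longrightarrow> h x = (1::real)" "\<And>x. x \<notin> ball p (r p) \<Longrightarrow> h x = 0"
      using C1_bump[OF r(1)[OF p]] by blast
    define \<psi>' P' where "\<psi>' x = \<psi> x * h x" and "P' x = \<psi> x *\<^sub>R Q x + h x *\<^sub>R P x" for x
    have t: "test_fun \<psi>' P'"
      unfolding \<psi>'_def P'_def by (rule test_fun_mult[OF insert.prems(2) test_fun_C1[OF h(1,2)]])
    have "flux \<psi>' P' = 0" using r(2)[OF p t] h(4) by (simp add: \<psi>'_def)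
    \<comment> \<open>The remainder \<open>\<psi> x * (1 - h x)\<close> vanishes on the half-radius
      ball at \<open>p\<close>, so in \<open>\<Omega>\<close> it is nonzero only inside the
      remaining balls.\<close>
    moreover have "flux (\<lambda>x. \<psi> x - \<psi>' x) (\<lambda>x. P x - P' x) = 0"
    proof (rule insert.IH)
      show "test_fun (\<lambda>x. \<psi> x - \<psi>' x) (\<lambda>x. P x - P' x)" by (rule test_fun_diff[OF insert.prems(2) t])
      show "\<forall>x\<in>\<Omega> - (\<Union>p\<in>F. ball p (r p / 2)). \<psi> x - \<psi>' x = 0"
        using insert.prems(3) h(3) by (auto simp: \<psi>'_def)
    qed (use insert.prems in auto)
    ultimately show ?case using flux_diff[OF insert.prems(2) t] by simp
  qed
  then show ?thesis using test F(3) closure_subset by blast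
qed

section \<open>Vanishing of the flux near a single point\<close>

lemma interior_local:
  assumes "p \<in> \<Omega>"
  shows "\<exists>r>0. \<forall>\<psi> P. test_fun \<psi> P \<longrightarrow> (\<forall>x\<in>\<Omega> - ball p r. \<psi> x = 0) \<longrightarrow> flux \<psi> P = 0"
proof -
  obtain r where "r > 0" "cball p r \<subseteq> \<Omega>"
    using open_domain assms open_contains_cball by blast
  then show ?thesis
    using flux_compact_support[of _ _ "cball p r"] by (intro exI[of _ r]) auto
qed

text \<open>\<open>outward_unit_normal\<close> accepts any defining function as witness, so the
  normalised gradient of the given \<open>g\<close> is itself a normal, and rescaling does not
  affect orthogonality.\<close>

lemma defining_function_tangential:
  assumes ldf: "local_defining_function \<Omega> U g" and g: "\<And>x. x \<in> U \<Longrightarrow> GDERIV g x :> N x"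
    and q: "q \<in> frontier \<Omega>" "q \<in> U"
  shows "N q \<bullet> G q = 0"
proof -
  have "outward_unit_normal \<Omega> q (sgn (N q))"
    unfolding outward_unit_normal_def using assms by blast
  then have "G q \<bullet> sgn (N q) = 0" by (rule tangential)
  then show ?thesis by (auto simp: sgn_div_norm inner_commute)
qed

text \<open>The points with \<open>\<bar>N x \<bullet> G x\<bar> \<ge> \<eta>\<close> form a compact
  set \<open>A\<close> that misses the boundary, so \<open>g\<close> has a negative maximum on it,
  if it is nonempty. Minus that maximum is the required \<open>\<epsilon>\<close>.\<close>

lemma defining_function_small:
  assumes ldf: "local_defining_function \<Omega> U g"
    and g: "\<And>x. x \<in> U \<Longrightarrow> GDERIV g x :> N x" "continuous_on U N"
    and K: "compact K" "K \<subseteq> U" and \<eta>: "\<eta> > 0"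
  obtains \<epsilon> where "\<epsilon> > 0" "\<And>x. \<lbrakk>x \<in> closure \<Omega> \<inter> K; - \<epsilon> < g x\<rbrakk> \<Longrightarrow> \<bar>N x \<bullet> G x\<bar> \<le> \<eta>"
proof -
  define A where "A = (closure \<Omega> \<inter> K) \<inter> (\<lambda>x. \<bar>N x \<bullet> G x\<bar>) -` {\<eta>..}"
  have cl: "closed (closure \<Omega> \<inter> K)" using K(1) by (simp add: closed_Int compact_imp_closed)
  have "continuous_on (closure \<Omega> \<inter> K) (\<lambda>x. \<bar>N x \<bullet> G x\<bar>)"
    using K(2) g(2) cont_field by (intro continuous_intros) (auto intro: continuous_on_subset)
  then have "closed A" unfolding A_def using cl by (intro continuous_closed_preimage) auto
  then have cA: "compact A" using K(1) unfolding A_def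
    by (metis closed_Int_compact inf.left_idem inf_assoc inf_commute)
  have neg: "g x < 0" if "x \<in> A" for x
  proof (rule ccontr)
    assume "\<not> g x < 0"
    moreover have x: "x \<in> U" "x \<in> closure \<Omega>" using that K(2) by (auto simp: A_def)
    ultimately have "x \<in> frontier \<Omega>"
      using ldf open_domain by (auto simp: local_defining_function_def frontier_def interior_open)
    then have "N x \<bullet> G x = 0" using defining_function_tangential[OF ldf g(1)] x by blast
    then show False using that \<eta> by (simp add: A_def)
  qed
  show ?thesis
  proof (cases "A = {}")
    case True
    \<comment> \<open>Any positive value works here, as no point violates the bound.\<close>
    then show ?thesis by (intro that[of 1]) (auto simp: A_def intro: less_imp_le)
  next
    case False
    have "continuous_on A g" using g(1) K(2) by (intro GDERIV_continuous_on[of _ g N]) (auto simp: A_def)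
    then obtain x0 where x0: "x0 \<in> A" "\<And>x. x \<in> A \<Longrightarrow> g x \<le> g x0"
      using continuous_attains_sup[OF cA False] by blast
    show ?thesis
    proof (rule that[of "- g x0"])
      show "\<bar>N x \<bullet> G x\<bar> \<le> \<eta>" if "x \<in> closure \<Omega> \<inter> K" "- (- g x0) < g x" for x
        using x0(2)[of x] that by (force simp: A_def)
    qed (use neg x0 in simp)
  qed
qed

text \<open>Within \<open>ball p r\<close>, \<open>w\<close> is 0 where
  \<open>g x \<ge> - \<epsilon>\<close> and 1 where \<open>g x \<le> - (3 * \<epsilon>)\<close>, so
  \<open>\<psi> x * w x\<close> vanishes off a compact subset of \<open>\<Omega>\<close> and has no
  flux. The product rule leaves an error term that is at most
  \<open>\<Psi> * \<eta> / \<epsilon>\<close> on a strip of volume at most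
  \<open>C * \<epsilon>\<close>.\<close>

lemma cutoff_flux_bound:
  assumes ldf: "local_defining_function \<Omega> U g"
    and g: "\<And>x. x \<in> U \<Longrightarrow> GDERIV g x :> N x" "continuous_on U N"
    and r: "0 < s" "s < r" "cball p r \<subseteq> U"
    and test: "test_fun \<psi> P" and supp: "\<And>x. x \<in> \<Omega> - ball p s \<Longrightarrow> \<psi> x = 0"
    and \<Psi>: "\<And>x. x \<in> \<Omega> \<Longrightarrow> \<bar>\<psi> x\<bar> \<le> \<Psi>" and \<Psi>0: "0 \<le> \<Psi>"
    and strip: "measure lebesgue {x \<in> ball p r. - (3 * \<epsilon>) < g x \<and> g x < 0} \<le> C * \<epsilon>"
    and \<epsilon>: "\<epsilon> > 0"
    and small: "\<And>x. \<lbrakk>x \<in> closure \<Omega> \<inter> cball p s; - (3 * \<epsilon>) < g x\<rbrakk> \<Longrightarrow> \<bar>N x \<bullet> G x\<bar> \<le> \<eta>"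
    and \<eta>: "\<eta> > 0"
    and w_def: "w = (\<lambda>x. if x \<in> ball p r then smoothstep (- g x / \<epsilon> - 1) else 1)"
  shows "(\<lambda>x. w x * (\<psi> x * dvg x + P x \<bullet> G x)) integrable_on \<Omega>"
    "\<bar>integral \<Omega> (\<lambda>x. w x * (\<psi> x * dvg x + P x \<bullet> G x))\<bar> \<le> \<Psi> * \<eta> * C"
proof -
  note T = test_funD[OF test]
  define W where "W x = (smoothstep' (- g x / \<epsilon> - 1) * (- 1 / \<epsilon>)) *\<^sub>R N x" for x
  \<comment> \<open>\<open>E\<close> is \<open>\<psi>\<close> times the gradient of
    \<open>w\<close>. A jump of \<open>w\<close> at the sphere of radius \<open>r\<close> is
    harmless, because \<open>\<psi>\<close> already vanishes outside the smaller ball.\<close>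
  define E where "E x = (if x \<in> ball p r then \<psi> x *\<^sub>R W x else 0)" for x
  define \<phi> where "\<phi> x = \<psi> x * w x" for x
  define Q where "Q x = E x + w x *\<^sub>R P x" for x
  have ballU: "ball p r \<subseteq> U" using r(3) ball_subset_cball by blast
  have open_out: "open (\<Omega> - cball p s)" using open_domain by (simp add: open_Diff)
  have out: "\<psi> x = 0" "P x = 0" if "x \<in> \<Omega> - cball p s" for x
  proof -
    show "\<psi> x = 0" using supp that by auto
    have "GDERIV \<psi> x :> 0"
      by (rule GDERIV_cong_open[OF GDERIV_const open_out that]) (use supp in auto)
    then show "P x = 0" using T(1) that GDERIV_unique by blast
  qed
  \<comment> \<open>Because \<open>s < r\<close>, the ball of radius \<open>r\<close> and the
    complement of \<open>cball p s\<close> together cover \<open>\<Omega>\<close>, so continuity can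
    be checked on two open pieces.\<close>
  have glue: "continuous_on \<Omega> f"
    if "continuous_on (\<Omega> \<inter> ball p r) f" "\<And>x. x \<in> \<Omega> - cball p s \<Longrightarrow> f x = 0" for f :: "'a \<Rightarrow> 'a"
  proof -
    have "continuous_on (\<Omega> - cball p s) f"
      using that(2) by (intro continuous_on_eq[OF continuous_on_const[of _ 0]]) simp
    then have "continuous_on ((\<Omega> \<inter> ball p r) \<union> (\<Omega> - cball p s)) f"
      using that(1) open_out open_domain by (intro continuous_on_open_Un) auto
    moreover have "(\<Omega> \<inter> ball p r) \<union> (\<Omega> - cball p s) = \<Omega>" using r(2) by auto
    ultimately show ?thesis by simp
  qed
  have cont_g: "continuous_on U g" using g(1) by (rule GDERIV_continuous_on)
  have cont_N': "continuous_on (\<Omega> \<inter> ball p r) N" "continuous_on (\<Omega> \<inter> ball p r) g"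
    using cont_g g(2) ballU by (auto intro: continuous_on_subset)
  have cont_psi: "continuous_on (\<Omega> \<inter> ball p r) \<psi>" "continuous_on (\<Omega> \<inter> ball p r) P"
    using T by (auto intro: continuous_on_subset)
  have contE: "continuous_on \<Omega> E"
  proof (rule glue)
    have "continuous_on (\<Omega> \<inter> ball p r) (\<lambda>x. \<psi> x *\<^sub>R W x)"
      unfolding W_def using cont_N' cont_psi \<epsilon>
      by (intro continuous_intros continuous_on_compose2[OF continuous_on_smoothstep'[of UNIV]]) auto
    then show "continuous_on (\<Omega> \<inter> ball p r) E"
      by (rule continuous_on_eq) (simp add: E_def)
  qed (use out in \<open>simp add: E_def\<close>)
  have contwP: "continuous_on \<Omega> (\<lambda>x. w x *\<^sub>R P x)"
  proof (rule glue)
    have "continuous_on (\<Omega> \<inter> ball p r) (\<lambda>x. smoothstep (- g x / \<epsilon> - 1) *\<^sub>R P x)"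
      using cont_N' cont_psi \<epsilon>
      by (intro continuous_intros continuous_on_compose2[OF continuous_on_smoothstep[of UNIV]]) auto
    then show "continuous_on (\<Omega> \<inter> ball p r) (\<lambda>x. w x *\<^sub>R P x)"
      by (rule continuous_on_eq) (simp add: w_def)
  qed (use out in simp)
  have w01: "0 \<le> w x" "w x \<le> 1" for x using smoothstep_bounds by (auto simp: w_def)
  have "bounded (N ` cball p s)"
  proof -
    have "cball p s \<subseteq> U" using r by (meson less_imp_le order_trans subset_cball)
    then have "continuous_on (cball p s) N" using g(2) continuous_on_subset by blast
    then show ?thesis using compact_continuous_image compact_imp_bounded compact_cball by blast
  qed
  then obtain B where B: "\<And>x. x \<in> cball p s \<Longrightarrow> norm (N x) \<le> B"
    unfolding bounded_iff by blast
  have boundE: "norm (E x) \<le> \<Psi> * (1 / \<epsilon> * B)" if "x \<in> \<Omega>" for x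
  proof (cases "x \<in> cball p s")
    case True
    have B0: "0 \<le> B" using B[OF True] norm_ge_zero order_trans by blast
    have "norm (W x) = \<bar>smoothstep' (- g x / \<epsilon> - 1)\<bar> * (1 / \<epsilon> * norm (N x))"
      using \<epsilon> by (simp add: W_def abs_mult)
    also have "\<dots> \<le> 1 * (1 / \<epsilon> * B)"
      using \<epsilon> B[OF True] smoothstep'_bounds by (intro mult_mono) (auto intro: divide_right_mono)
    finally have "norm (\<psi> x *\<^sub>R W x) \<le> \<Psi> * (1 / \<epsilon> * B)"
      unfolding norm_scaleR using \<Psi>[OF that] \<Psi>0 by (intro mult_mono) auto
    then show ?thesis using \<Psi>0 \<epsilon> B0 by (simp add: E_def)
  next
    case False
    \<comment> \<open>\<open>B\<close> bounds \<open>N\<close> only on \<open>cball p s\<close>,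
      which \<open>x\<close> does not belong to, so the sign of \<open>B\<close> is read off at the
      centre.\<close>
    have "norm (N p) \<le> B" using B r(1) by simp
    then have "0 \<le> B" using norm_ge_zero order_trans by blast
    then show ?thesis using out(1)[of x] False that \<Psi>0 \<epsilon> by (simp add: E_def)
  qed
  have test': "test_fun \<phi> Q"
    unfolding test_fun_def
  proof (intro conjI ballI)
    fix x assume x: "x \<in> \<Omega>"
    show "GDERIV \<phi> x :> Q x"
    proof (cases "x \<in> ball p r")
      case True
      then have xU: "x \<in> U" using ballU by blast
      have "GDERIV (\<lambda>x. - g x / \<epsilon> - 1) x :> (- 1 / \<epsilon>) *\<^sub>R N x"
        using g(1)[OF xU] \<epsilon> unfolding gderiv_def
        by (auto intro!: derivative_eq_intros)
      then have "GDERIV (\<lambda>x. smoothstep (- g x / \<epsilon> - 1)) x :> W x"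
        using GDERIV_smoothstep unfolding W_def scaleR_scaleR[symmetric] by blast
      then have "GDERIV w x :> W x"
        by (rule GDERIV_cong_open[OF _ open_ball True]) (simp add: w_def)
      then show ?thesis
        using GDERIV_mult[OF T(1)[OF x]] True by (simp add: \<phi>_def[abs_def] Q_def E_def)
    next
      case False
      then have x': "x \<in> \<Omega> - cball p s" using x r(2) by auto
      then have "Q x = 0" using out by (simp add: Q_def E_def)
      moreover have "GDERIV \<phi> x :> 0"
        by (rule GDERIV_cong_open[OF GDERIV_const open_out x']) (use out in \<open>simp add: \<phi>_def\<close>)
      ultimately show ?thesis by simp
    qed
  next
    show "continuous_on \<Omega> Q" unfolding Q_def by (rule continuous_on_add[OF contE contwP])
    have "norm (\<phi> x) \<le> \<Psi>" if "x \<in> \<Omega>" for x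
      using mult_mono[OF \<Psi>[OF that] w01(2)[of x]] w01(1)[of x] \<Psi>0 by (simp add: \<phi>_def abs_mult)
    then show "bounded (\<phi> ` \<Omega>)" by (auto simp: bounded_iff)
    have "bounded (E ` \<Omega>)" using boundE by (auto simp: bounded_iff)
    moreover have "bounded ((\<lambda>x. w x *\<^sub>R P x) ` \<Omega>)"
    proof -
      obtain c where "\<And>x. x \<in> \<Omega> \<Longrightarrow> norm (P x) \<le> c" using T(5) by (auto simp: bounded_iff)
      then have "norm (w x *\<^sub>R P x) \<le> c" if "x \<in> \<Omega>" for x
        using that w01[of x] mult_left_le_one_le[of "norm (P x)" "w x"] by force
      then show ?thesis by (auto simp: bounded_iff)
    qed
    ultimately show "bounded (Q ` \<Omega>)" unfolding Q_def by (rule bounded_plus_comp)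
  qed
  \<comment> \<open>The part of \<open>\<Omega>\<close> where \<open>\<psi> x * w x\<close> can be
    nonzero. The condition \<open>g x \<le> - \<epsilon>\<close> keeps it away from the
    boundary.\<close>
  define K where "K = closure \<Omega> \<inter> (cball p s \<inter> g -` {..- \<epsilon>})"
  have sU: "cball p s \<subseteq> U" using r by (meson less_imp_le order_trans subset_cball)
  have "closed (cball p s \<inter> g -` {..- \<epsilon>})"
    using cont_g sU by (intro continuous_closed_preimage) (auto intro: continuous_on_subset)
  then have "compact K"
    unfolding K_def by (rule compact_Int_closed[OF compact_closure_domain])
  moreover have "K \<subseteq> \<Omega>"
  proof
    fix x assume x: "x \<in> K"
    then have "x \<in> U" "g x < 0" "x \<in> closure \<Omega>" using sU \<epsilon> by (auto simp: K_def)
    then show "x \<in> \<Omega>" using ldf unfolding local_defining_function_def by blast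
  qed
  moreover have "\<phi> x = 0" if x: "x \<in> \<Omega> - K" for x
  proof (cases "x \<in> cball p s")
    case True
    then have "- \<epsilon> < g x" using x closure_subset by (force simp: K_def)
    then have "- g x / \<epsilon> - 1 \<le> 0" using \<epsilon> by (simp add: field_simps)
    moreover have "x \<in> ball p r" using True r(2) by auto
    ultimately show ?thesis by (simp add: \<phi>_def w_def smoothstep_eq_0)
  qed (use out x in \<open>simp add: \<phi>_def\<close>)
  ultimately have flux0: "flux \<phi> Q = 0" by (rule flux_compact_support[OF test'])
  define e where "e x = E x \<bullet> G x" for x
  \<comment> \<open>The product rule for \<open>\<psi> x * w x\<close>, solved for the terms without
    the gradient of \<open>w\<close>.\<close>
  have split: "w x * (\<psi> x * dvg x + P x \<bullet> G x) = (\<phi> x * dvg x + Q x \<bullet> G x) - e x" for x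
    by (simp add: \<phi>_def Q_def e_def inner_add_left algebra_simps)
  define S where "S = {x \<in> ball p r. - (3 * \<epsilon>) < g x \<and> g x < 0}"
  have "S = ball p r \<inter> g -` {- (3 * \<epsilon>)<..<0}" by (auto simp: S_def)
  moreover have "open (ball p r \<inter> g -` {- (3 * \<epsilon>)<..<0})"
    using cont_g ballU by (intro continuous_open_preimage) (auto intro: continuous_on_subset)
  ultimately have "open S" by simp
  then have S: "S \<in> lmeasurable"
    by (intro lmeasurable_open bounded_subset[OF bounded_ball[of p r]]) (auto simp: S_def)
  have e_bound: "\<bar>e x\<bar> \<le> \<Psi> * \<eta> / \<epsilon> * indicat_real S x" if x: "x \<in> \<Omega>" for x
  proof (cases "x \<in> ball p s \<and> smoothstep' (- g x / \<epsilon> - 1) \<noteq> 0")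
    case True
    \<comment> \<open>The derivative of the profile lives on (0, 2), which corresponds to
      \<open>g x\<close> between \<open>- (3 * \<epsilon>)\<close> and \<open>- \<epsilon>\<close>;
      hence the factor 3 in \<open>small\<close> and \<open>strip\<close>.\<close>
    then have "0 < - g x / \<epsilon> - 1" "- g x / \<epsilon> - 1 < 2" using smoothstep'_eq_0 not_le by blast+
    then have gx: "g x < 0" "- (3 * \<epsilon>) < g x" using \<epsilon> by (simp_all add: field_simps)
    then have xS: "x \<in> S" using True r(2) by (simp add: S_def)
    have "\<bar>N x \<bullet> G x\<bar> \<le> \<eta>" using True x closure_subset gx by (intro small) auto
    then have k: "\<bar>smoothstep' (- g x / \<epsilon> - 1)\<bar> * (1 / \<epsilon> * \<bar>N x \<bullet> G x\<bar>) \<le> 1 * (1 / \<epsilon> * \<eta>)"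
      using \<epsilon> smoothstep'_bounds by (intro mult_mono) (auto intro: divide_right_mono)
    then have "\<bar>\<psi> x\<bar> * (\<bar>smoothstep' (- g x / \<epsilon> - 1)\<bar> * (1 / \<epsilon> * \<bar>N x \<bullet> G x\<bar>)) \<le> \<Psi> * (1 * (1 / \<epsilon> * \<eta>))"
      using \<epsilon> \<Psi>0 by (intro mult_mono[OF \<Psi>[OF x] k]) auto
    moreover have "e x = \<psi> x * (smoothstep' (- g x / \<epsilon> - 1) * (- 1 / \<epsilon>) * (N x \<bullet> G x))"
      using True r(2) by (simp add: e_def E_def W_def)
    ultimately show ?thesis using xS \<epsilon> by (simp add: abs_mult)
  next
    case False
    then have "e x = 0" using supp x by (auto simp: e_def E_def W_def)
    then show ?thesis using \<Psi>0 \<epsilon> \<eta> by simp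
  qed
  have e_int: "e integrable_on \<Omega>"
  proof (rule set_lebesgue_integral_eq_integral(1)[OF absolutely_integrable_bounded_continuous[OF open_domain bounded_domain]])
    show "continuous_on \<Omega> e" unfolding e_def using contE cont_field' by (intro continuous_intros)
    show "\<bar>e x\<bar> \<le> \<Psi> * \<eta> / \<epsilon>" if "x \<in> \<Omega>" for x
    proof -
      have "\<Psi> * \<eta> / \<epsilon> * indicat_real S x \<le> \<Psi> * \<eta> / \<epsilon> * 1"
        using \<Psi>0 \<eta> \<epsilon> by (intro mult_left_mono indicator_le_1) auto
      then show ?thesis using e_bound[OF that] by linarith
    qed
  qed
  note \<phi>_int = flux_integrable[OF test', THEN set_lebesgue_integral_eq_integral(1)]
  show "(\<lambda>x. w x * (\<psi> x * dvg x + P x \<bullet> G x)) integrable_on \<Omega>"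
    unfolding split using \<phi>_int e_int by (rule integrable_diff)
  have "integral \<Omega> (\<lambda>x. w x * (\<psi> x * dvg x + P x \<bullet> G x)) = flux \<phi> Q - integral \<Omega> e"
    unfolding split flux_def using \<phi>_int e_int by (rule integral_diff)
  then have "\<bar>integral \<Omega> (\<lambda>x. w x * (\<psi> x * dvg x + P x \<bullet> G x))\<bar> = \<bar>integral \<Omega> e\<bar>"
    using flux0 by simp
  also have "\<dots> \<le> integral \<Omega> (\<lambda>x. \<Psi> * \<eta> / \<epsilon> * indicat_real S x)"
  proof -
    have "\<Omega> \<inter> S \<in> lmeasurable" "S \<inter> \<Omega> \<in> lmeasurable"
      using S open_domain bounded_domain by (auto intro: fmeasurable.Int lmeasurable_open)
    then have "(\<lambda>x. \<Psi> * \<eta> / \<epsilon> * indicat_real S x) integrable_on \<Omega>"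
      by (intro integrable_on_mult_right) (simp add: integrable_on_indicator)
    from integral_norm_bound_integral[OF e_int this] show ?thesis
      using e_bound unfolding real_norm_def .
  qed
  also have "\<dots> = \<Psi> * \<eta> / \<epsilon> * measure lebesgue (S \<inter> \<Omega>)"
    using S open_domain bounded_domain
    by (subst integral_mult_right, subst integral_indicator) (auto intro: fmeasurable.Int lmeasurable_open)
  also have "\<dots> \<le> \<Psi> * \<eta> / \<epsilon> * (C * \<epsilon>)"
  proof -
    have "measure lebesgue (S \<inter> \<Omega>) \<le> measure lebesgue S"
      using S open_domain by (intro measure_mono_fmeasurable) auto
    also have "\<dots> \<le> C * \<epsilon>" using strip unfolding S_def .
    finally show ?thesis using \<Psi>0 \<eta> \<epsilon> by (intro mult_left_mono) auto
  qed
  also have "\<dots> = \<Psi> * \<eta> * C" using \<epsilon> by simp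
  finally show "\<bar>integral \<Omega> (\<lambda>x. w x * (\<psi> x * dvg x + P x \<bullet> G x))\<bar> \<le> \<Psi> * \<eta> * C" .
qed

text \<open>Two limits in this order: for fixed \<open>\<eta>\<close> the cutoffs tend to 1
  pointwise on \<open>\<Omega>\<close>, which bounds the flux by \<open>\<eta>\<close> times a
  constant independent of \<open>\<eta>\<close>; then \<open>\<eta>\<close> tends to 0.\<close>

lemma boundary_local:
  assumes p: "p \<in> frontier \<Omega>"
  shows "\<exists>r>0. \<forall>\<psi> P. test_fun \<psi> P \<longrightarrow> (\<forall>x\<in>\<Omega> - ball p r. \<psi> x = 0) \<longrightarrow> flux \<psi> P = 0"
proof -
  obtain U g where pU: "p \<in> U" and ldf: "local_defining_function \<Omega> U g"
    using boundary p unfolding smooth_boundary_def by blast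
  then have U: "open U" "smooth_on U g" "\<And>x. x \<in> U \<Longrightarrow> \<not> (GDERIV g x :> 0)"
    by (auto simp: local_defining_function_def)
  obtain N where g: "\<And>x. x \<in> U \<Longrightarrow> GDERIV g x :> N x" "continuous_on U N"
    using smooth_on_gradient[OF U(2)] by blast
  have "N p \<noteq> 0" using U(3)[OF pU] g(1)[OF pU] by metis
  then obtain r C where r: "r > 0" "cball p r \<subseteq> U" and
    C: "\<And>\<epsilon>. \<lbrakk>0 < \<epsilon>; \<epsilon> \<le> 1\<rbrakk> \<Longrightarrow> measure lebesgue {x \<in> ball p r. - \<epsilon> < g x \<and> g x < 0} \<le> C * \<epsilon>"
    using strip_measure_bound_gradient[OF U(1) pU g] by blast
  define s where "s = r / 2"
  have s: "0 < s" "s < r" "cball p s \<subseteq> U" using r by (auto simp: s_def)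
  have "flux \<psi> P = 0" if test: "test_fun \<psi> P" and supp: "\<And>x. x \<in> \<Omega> - ball p s \<Longrightarrow> \<psi> x = 0" for \<psi> P
  proof -
    define F where "F x = \<psi> x * dvg x + P x \<bullet> G x" for x
    note F_abs = flux_integrable[OF test, folded F_def]
    obtain \<Psi> where \<Psi>: "\<And>x. x \<in> \<Omega> \<Longrightarrow> \<bar>\<psi> x\<bar> \<le> \<Psi>" and \<Psi>0: "0 \<le> \<Psi>"
      using test_funD(4)[OF test] unfolding bounded_pos by (auto intro: less_imp_le)
    define w where "w \<epsilon> = (\<lambda>x. if x \<in> ball p r then smoothstep (- g x / \<epsilon> - 1) else 1)" for \<epsilon>
    have main: "\<bar>flux \<psi> P\<bar> \<le> \<Psi> * \<eta> * (3 * C)" if \<eta>: "\<eta> > 0" for \<eta>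
    proof -
      obtain \<epsilon>0 where \<epsilon>0: "\<epsilon>0 > 0"
        "\<And>x. \<lbrakk>x \<in> closure \<Omega> \<inter> cball p s; - \<epsilon>0 < g x\<rbrakk> \<Longrightarrow> \<bar>N x \<bullet> G x\<bar> \<le> \<eta>"
        using defining_function_small[OF ldf g compact_cball s(3) \<eta>] by blast
      \<comment> \<open>The cutoff reaches down to \<open>g x = - (3 * \<epsilon> n)\<close>, so
        \<open>3 * \<epsilon> n\<close> must be at most 1 for the strip estimate and at most
        \<open>\<epsilon>0\<close> for the bound on the normal component.\<close>
      define \<delta> where "\<delta> = min 1 \<epsilon>0 / 3"
      define \<epsilon> where "\<epsilon> n = \<delta> / real (Suc n)" for n
      have \<delta>: "0 < \<delta>" "3 * \<delta> \<le> 1" "3 * \<delta> \<le> \<epsilon>0" using \<epsilon>0(1) by (auto simp: \<delta>_def)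
      have "\<epsilon> n \<le> \<delta>" "0 < \<epsilon> n" for n using \<delta>(1) by (auto simp: \<epsilon>_def field_simps)
      then have \<epsilon>: "0 < \<epsilon> n" "3 * \<epsilon> n \<le> 1" "3 * \<epsilon> n \<le> \<epsilon>0" for n
        using \<delta> by (smt (verit))+
      have strip: "measure lebesgue {x \<in> ball p r. - (3 * \<epsilon> n) < g x \<and> g x < 0} \<le> (3 * C) * \<epsilon> n" for n
        using C[of "3 * \<epsilon> n"] \<epsilon>[of n] by (simp add: mult_ac)
      have small: "\<bar>N x \<bullet> G x\<bar> \<le> \<eta>" if "x \<in> closure \<Omega> \<inter> cball p s" "- (3 * \<epsilon> n) < g x" for n x
        using \<epsilon>0(2)[OF that(1)] that(2) \<epsilon>(3)[of n] by linarith
      note cut = cutoff_flux_bound[OF ldf g s(1,2) r(2) test supp \<Psi> \<Psi>0 strip \<epsilon>(1) small \<eta> w_def, folded F_def]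
      have "(\<lambda>n. integral \<Omega> (\<lambda>x. w (\<epsilon> n) x * F x)) \<longlonglongrightarrow> integral \<Omega> F"
      proof (rule dominated_convergence(2)[where h = "\<lambda>x. \<bar>F x\<bar>"])
        show "(\<lambda>x. w (\<epsilon> n) x * F x) integrable_on \<Omega>" for n using cut(1) .
        show "(\<lambda>x. \<bar>F x\<bar>) integrable_on \<Omega>"
          using F_abs unfolding absolutely_integrable_on_def by simp
        show "norm (w (\<epsilon> n) x * F x) \<le> \<bar>F x\<bar>" for n x
          using smoothstep_bounds by (simp add: w_def abs_mult mult_left_le_one_le)
        show "(\<lambda>n. w (\<epsilon> n) x * F x) \<longlonglongrightarrow> F x" if x: "x \<in> \<Omega>" for x
        proof (cases "x \<in> ball p r")
          case True
          then have "x \<in> U" using r(2) by auto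
          then have gx: "g x < 0" using ldf x unfolding local_defining_function_def by blast
          \<comment> \<open>The value \<open>g x < 0\<close> is fixed while the depth
            \<open>3 * \<epsilon> n\<close> of the strip shrinks to 0, so from \<open>n0\<close> on
            \<open>x\<close> lies beyond the strip and the cutoff is exactly 1.\<close>
          obtain n0 :: nat where n0: "3 * \<delta> / (- g x) < real n0" using reals_Archimedean2 by blast
          have "w (\<epsilon> n) x = 1" if "n0 \<le> n" for n
          proof -
            have "3 * \<delta> / (- g x) < real (Suc n)" using n0 that by linarith
            then have "3 * \<delta> < (- g x) * real (Suc n)"
              using gx by (subst (asm) pos_divide_less_eq) (auto simp: mult.commute)
            then have "2 \<le> - g x / \<epsilon> n - 1" using \<delta>(1) by (simp add: \<epsilon>_def field_simps)
            then show ?thesis using True smoothstep_eq_1 by (simp add: w_def)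
          qed
          then have "\<forall>\<^sub>F n in sequentially. w (\<epsilon> n) x * F x = F x"
            by (intro eventually_sequentiallyI[of n0]) simp
          then show ?thesis by (rule tendsto_eventually)
        qed (simp add: w_def)
      qed
      then have "(\<lambda>n. \<bar>integral \<Omega> (\<lambda>x. w (\<epsilon> n) x * F x)\<bar>) \<longlonglongrightarrow> \<bar>flux \<psi> P\<bar>"
        unfolding flux_def F_def by (rule tendsto_rabs)
      then show ?thesis
        by (rule tendsto_upperbound) (use cut(2) in auto)
    qed
    have "((\<lambda>\<eta>. \<Psi> * \<eta> * (3 * C)) \<longlongrightarrow> \<Psi> * 0 * (3 * C)) (at_right 0)"
      by (intro tendsto_intros)
    then have "\<bar>flux \<psi> P\<bar> \<le> \<Psi> * 0 * (3 * C)"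
      by (rule tendsto_lowerbound) (use main in \<open>auto intro: eventually_mono[OF eventually_at_right_less]\<close>)
    then show ?thesis by simp
  qed
  then show ?thesis using s(1) by blast
qed

theorem flux_eq_0:
  assumes "test_fun \<psi> P"
  shows "flux \<psi> P = 0"
proof (rule flux_eq_0_if_local[OF _ assms])
  fix p assume "p \<in> closure \<Omega>"
  then have "p \<in> \<Omega> \<or> p \<in> frontier \<Omega>"
    using open_domain by (auto simp: frontier_def interior_open)
  then show "\<exists>r>0. \<forall>\<psi> P. test_fun \<psi> P \<longrightarrow> (\<forall>x\<in>\<Omega> - ball p r. \<psi> x = 0) \<longrightarrow> flux \<psi> P = 0"
    using interior_local boundary_local by blast
qed

end

section \<open>Neumann solutions\<close>

text \<open>Nonnegativity makes the integral over a closed box around \<open>x\<close> no larger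
  than that over \<open>S\<close>, which reduces the claim to a continuous function on a compact
  box.\<close>

lemma continuous_nonneg_integral_le_0_imp_0:
  fixes f :: "'a::euclidean_space \<Rightarrow> real"
  assumes "open S" and cont: "continuous_on S f" and nonneg: "\<And>x. x \<in> S \<Longrightarrow> 0 \<le> f x"
    and int: "f integrable_on S" "integral S f \<le> 0" and x: "x \<in> S"
  shows "f x = 0"
proof -
  obtain a b where ab: "x \<in> box a b" "cbox a b \<subseteq> S"
    by (rule open_contains_cbox[OF \<open>open S\<close> x])
  have c: "continuous_on (cbox a b) f" using cont ab(2) continuous_on_subset by blast
  have "integral (cbox a b) f \<le> integral S f"
    using ab(2) integrable_continuous[OF c] int(1) nonneg by (intro integral_subset_le) auto
  moreover have "0 \<le> integral (cbox a b) f"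
    using integrable_continuous[OF c] nonneg ab(2) by (intro integral_nonneg) auto
  ultimately have "integral (cbox a b) f = 0" using int(2) by linarith
  then have "\<forall>y\<in>cbox a b. f y = 0"
    using integral_cbox_eq_0_iff[OF c] ab nonneg by blast
  then show ?thesis using ab(1) box_subset_cbox by blast
qed

lemma neumann_solution_const:
  assumes "\<And>x. x \<in> \<Omega> \<Longrightarrow> \<kappa> * \<rho> x * c = M x"
  shows "neumann_solution \<Omega> M \<kappa> \<rho> (\<lambda>x. c)"
proof -
  have "Ck_on 2 \<Omega> (\<lambda>x. c)" by (simp add: numeral_2_eq_2)
  moreover have "laplacian (\<lambda>x. c) x = 0" for x by (simp add: laplacian_def)
  ultimately show ?thesis
    unfolding neumann_solution_def using assms
    by (auto intro!: exI[of _ "\<lambda>x. 0"] GDERIV_const)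
qed

lemma neumann_solution_bounded:
  assumes "bounded \<Omega>" "neumann_solution \<Omega> M \<kappa> \<rho> u"
  obtains B where "\<And>x. x \<in> \<Omega> \<Longrightarrow> \<bar>u x\<bar> \<le> B"
proof -
  have "compact (u ` closure \<Omega>)"
    using assms unfolding neumann_solution_def by (intro compact_continuous_image) auto
  then obtain B where "\<forall>y\<in>u ` closure \<Omega>. norm y \<le> B"
    using compact_imp_bounded bounded_iff by blast
  then show ?thesis using that closure_subset by fastforce
qed

lemma neumann_solution_continuous: "neumann_solution \<Omega> M \<kappa> \<rho> u \<Longrightarrow> continuous_on \<Omega> u"
  unfolding neumann_solution_def
  by (elim conjE) (erule continuous_on_subset[OF _ closure_subset])

text \<open>A trap density may be unbounded: its sign turns integrability into absolute
  integrability, and boundedness of \<open>u\<close> controls the product.\<close>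

lemma neumann_solution_mult_integrable:
  fixes \<Omega> :: "'a::euclidean_space set"
  assumes dom: "bounded_smooth_domain \<Omega>" and trap: "trap_density \<Omega> \<rho>"
    and sol: "neumann_solution \<Omega> M \<kappa> \<rho>' u"
  shows "(\<lambda>x. u x * \<rho> x) absolutely_integrable_on \<Omega>"
proof (rule absolutely_integrable_continuous_mult)
  have bnd: "bounded \<Omega>" "open \<Omega>" using dom by (auto simp: bounded_smooth_domain_def)
  show "open \<Omega>" by (rule bnd)
  show "continuous_on \<Omega> u"
    using sol by (rule neumann_solution_continuous)
  show "bounded (u ` \<Omega>)"
    using neumann_solution_bounded[OF bnd(1) sol] by (metis bounded_iff imageE real_norm_def)
  show "\<rho> absolutely_integrable_on \<Omega>"
    using trap unfolding trap_density_def by (intro nonnegative_absolutely_integrable_1) auto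
qed

text \<open>The vanishing flux of the gradient field of \<open>u\<close>, taken with the test
  functions 1 and \<open>u x - c\<close>. The second case is the energy identity, with that gradient
  as the witness \<open>G\<close>.\<close>

lemma neumann_solution_test_identity:
  fixes \<Omega> :: "'a::euclidean_space set"
  assumes dom: "bounded_smooth_domain \<Omega>" and trap: "trap_density \<Omega> \<rho>"
    and M: "M absolutely_integrable_on \<Omega>"
    and sol: "neumann_solution \<Omega> M \<kappa> \<rho> u"
  shows "((\<lambda>x. \<kappa> * \<rho> x * u x - M x) has_integral 0) \<Omega>"
    and "\<exists>G :: 'a \<Rightarrow> 'a. continuous_on \<Omega> G \<and>
      ((\<lambda>x. (u x - c) * (\<kappa> * \<rho> x * u x - M x) + G x \<bullet> G x) has_integral 0) \<Omega>"
proof -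
  have \<Omega>: "open \<Omega>" "bounded \<Omega>" "smooth_boundary \<Omega>"
    using dom by (auto simp: bounded_smooth_domain_def)
  obtain G where G: "continuous_on (closure \<Omega>) G" "\<And>x. x \<in> \<Omega> \<Longrightarrow> GDERIV u x :> G x"
    "\<And>p n. outward_unit_normal \<Omega> p n \<Longrightarrow> G p \<bullet> n = 0"
    using sol unfolding neumann_solution_def by blast
  define du where "du b x = frechet_derivative u (at x) b" for b x
  define D where "D b x = frechet_derivative (du b) (at x)" for b x
  have "Ck_on 2 \<Omega> u" using sol by (simp add: neumann_solution_def)
  then have C2: "\<And>b x. x \<in> \<Omega> \<Longrightarrow> du b differentiable (at x)" "\<And>b. continuous_on \<Omega> (\<lambda>x. D b x b)"
    by (simp_all add: numeral_2_eq_2 du_def[abs_def] D_def)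
  have du: "du b x = G x \<bullet> b" if "x \<in> \<Omega>" for b x
  proof -
    have "(\<lambda>h. h \<bullet> G x) = frechet_derivative u (at x)"
      using G(2)[OF that] unfolding gderiv_def by (rule frechet_derivative_at)
    then show ?thesis unfolding du_def by (metis inner_commute)
  qed
  have lap: "(\<Sum>b\<in>Basis. D b x b) = \<kappa> * \<rho> x * u x - M x" if "x \<in> \<Omega>" for x
  proof -
    have "laplacian u x - \<kappa> * \<rho> x * u x = - M x" using sol that by (simp add: neumann_solution_def)
    moreover have "laplacian u x = (\<Sum>b\<in>Basis. D b x b)"
      by (simp add: laplacian_def D_def du_def[abs_def])
    ultimately show ?thesis by simp
  qed
  \<comment> \<open>Second derivatives of \<open>u\<close> may blow up at the boundary.
    Integrability of the divergence comes from the equation, which expresses it through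
    \<open>u x * \<rho> x\<close> and \<open>M x\<close>.\<close>
  have "(\<lambda>x. \<kappa> * (u x * \<rho> x) - M x) absolutely_integrable_on \<Omega>"
    using neumann_solution_mult_integrable[OF dom trap sol] M
    by (intro set_integral_diff set_integrable_mult_right)
  then have div_int: "(\<lambda>x. \<Sum>b\<in>Basis. D b x b) absolutely_integrable_on \<Omega>"
    by (rule set_integrable_cong[THEN iffD1, rotated 3]) (simp_all add: lap mult_ac)
  interpret tangential_field \<Omega> G D
  proof
    show "((\<lambda>y. G y \<bullet> b) has_derivative D b x) (at x)" if "x \<in> \<Omega>" for b x
      by (rule has_derivative_transform_within_open[OF _ \<Omega>(1) that du])
        (use C2(1)[OF that] in \<open>simp_all add: D_def frechet_derivative_works[symmetric]\<close>)
  qed (use \<Omega> G C2 div_int in auto)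
  have dvg: "dvg x = \<kappa> * \<rho> x * u x - M x" if "x \<in> \<Omega>" for x
    using lap[OF that] by (simp add: dvg_def)
  have identity: "((\<lambda>x. \<psi> x * (\<kappa> * \<rho> x * u x - M x) + P x \<bullet> G x) has_integral 0) \<Omega>"
    if "test_fun \<psi> P" for \<psi> P
  proof -
    have "((\<lambda>x. \<psi> x * dvg x + P x \<bullet> G x) has_integral 0) \<Omega>"
      using flux_eq_0[OF that] flux_integrable[OF that, THEN set_lebesgue_integral_eq_integral(1)]
      by (simp add: flux_def has_integral_iff)
    then show ?thesis by (rule has_integral_eq[rotated]) (simp add: dvg)
  qed
  have "test_fun (\<lambda>x. 1) (\<lambda>x. 0)" by (rule test_fun_C1) (simp_all add: GDERIV_const)
  from identity[OF this] show "((\<lambda>x. \<kappa> * \<rho> x * u x - M x) has_integral 0) \<Omega>" by simp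
  have test: "test_fun (\<lambda>x. u x - c) G"
    unfolding test_fun_def
  proof (intro conjI ballI)
    show "GDERIV (\<lambda>x. u x - c) x :> G x" if "x \<in> \<Omega>" for x
      using GDERIV_diff[OF G(2)[OF that] GDERIV_const[of c]] by simp
    obtain B where "\<And>x. x \<in> \<Omega> \<Longrightarrow> \<bar>u x\<bar> \<le> B"
      using neumann_solution_bounded[OF \<Omega>(2) sol] by blast
    then have "bounded (u ` \<Omega>)" by (auto simp: bounded_iff)
    then show "bounded ((\<lambda>x. u x - c) ` \<Omega>)" by (rule bounded_minus_comp) (auto simp: bounded_iff)
    obtain B where "\<And>x. x \<in> closure \<Omega> \<Longrightarrow> norm (G x) \<le> B" using field_bound by blast
    then show "bounded (G ` \<Omega>)" 
      using closure_subset[of \<Omega>] by (auto simp: bounded_iff intro!: exI[of _ B])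
  qed (rule cont_field')
  show "\<exists>G :: 'a \<Rightarrow> 'a. continuous_on \<Omega> G \<and>
      ((\<lambda>x. (u x - c) * (\<kappa> * \<rho> x * u x - M x) + G x \<bullet> G x) has_integral 0) \<Omega>"
    by (intro exI[of _ G] conjI cont_field' identity[OF test])
qed

section \<open>Lower bound for the supremum, and uniqueness of constant solutions\<close>

lemma neumann_solution_weighted_mean:
  fixes \<Omega> :: "'a::euclidean_space set"
  assumes dom: "bounded_smooth_domain \<Omega>" and trap: "trap_density \<Omega> \<rho>"
    and M: "M absolutely_integrable_on \<Omega>"
    and sol: "neumann_solution \<Omega> M \<kappa> \<rho> u" and \<kappa>: "\<kappa> > 0"
  shows "((\<lambda>x. \<rho> x * u x) has_integral integral \<Omega> M / \<kappa>) \<Omega>"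
proof -
  have "(M has_integral integral \<Omega> M) \<Omega>"
    using M set_lebesgue_integral_eq_integral(1) integrable_integral by blast
  from has_integral_add[OF neumann_solution_test_identity(1)[OF dom trap M sol] this]
  have "((\<lambda>x. \<kappa> * \<rho> x * u x) has_integral integral \<Omega> M) \<Omega>" by simp
  from has_integral_mult_right[OF this, of "1 / \<kappa>"] show ?thesis using \<kappa> by simp
qed

text \<open>The average of \<open>u\<close> weighted by \<open>\<rho>\<close> cannot exceed
  \<open>s\<close>, since \<open>\<rho>\<close> is nonnegative with total mass 1; the value of this
  average does not depend on the density.\<close>

lemma neumann_solution_upper_bound:
  fixes \<Omega> :: "'a::euclidean_space set"
  assumes dom: "bounded_smooth_domain \<Omega>" and trap: "trap_density \<Omega> \<rho>"
    and M: "M absolutely_integrable_on \<Omega>"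
    and sol: "neumann_solution \<Omega> M \<kappa> \<rho> u" and \<kappa>: "\<kappa> > 0"
    and le: "\<And>x. x \<in> \<Omega> \<Longrightarrow> u x \<le> s"
  shows "integral \<Omega> M / \<kappa> \<le> s"
proof -
  have "((\<lambda>x. s * \<rho> x) has_integral s * 1) \<Omega>"
    using trap unfolding trap_density_def by (intro has_integral_mult_right) auto
  then have "integral \<Omega> M / \<kappa> \<le> s * 1"
    using trap le
    by (intro has_integral_le[OF neumann_solution_weighted_mean[OF dom trap M sol \<kappa>]])
      (auto simp: trap_density_def mult.commute[of s] intro: mult_left_mono)
  then show ?thesis by simp
qed

text \<open>Substituting \<open>\<kappa> * \<rho> x * c\<close> for \<open>M x\<close> makes the
  integrand of the energy identity a sum of two nonnegative continuous terms, so both vanish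
  pointwise. Positivity of \<open>\<rho>\<close> then forces the value \<open>c\<close>.\<close>

lemma neumann_solution_unique_const:
  fixes \<Omega> :: "'a::euclidean_space set"
  assumes dom: "bounded_smooth_domain \<Omega>" and trap: "trap_density \<Omega> \<rho>"
    and M: "M absolutely_integrable_on \<Omega>"
    and sol: "neumann_solution \<Omega> M \<kappa> \<rho> u" and \<kappa>: "\<kappa> > 0"
    and \<rho>: "continuous_on \<Omega> \<rho>" "\<And>x. x \<in> \<Omega> \<Longrightarrow> 0 < \<rho> x"
    and c: "\<And>x. x \<in> \<Omega> \<Longrightarrow> \<kappa> * \<rho> x * c = M x" and x: "x \<in> \<Omega>"
  shows "u x = c"
proof -
  have "open \<Omega>" using dom by (simp add: bounded_smooth_domain_def)
  obtain G :: "'a \<Rightarrow> 'a" where G: "continuous_on \<Omega> G"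
    "((\<lambda>x. (u x - c) * (\<kappa> * \<rho> x * u x - M x) + G x \<bullet> G x) has_integral 0) \<Omega>"
    using neumann_solution_test_identity(2)[OF dom trap M sol] by blast
  define f where "f x = \<kappa> * \<rho> x * (u x - c)\<^sup>2 + G x \<bullet> G x" for x
  have "(f has_integral 0) \<Omega>"
    by (rule has_integral_eq[OF _ G(2)]) (simp add: f_def c[symmetric] power2_eq_square algebra_simps)
  moreover have "continuous_on \<Omega> u"
    using sol by (rule neumann_solution_continuous)
  then have "continuous_on \<Omega> f" unfolding f_def using G(1) \<rho>(1) by (intro continuous_intros)
  moreover have "0 \<le> f y" if "y \<in> \<Omega>" for y
    using \<rho>(2)[OF that] \<kappa> by (simp add: f_def)
  ultimately have "f x = 0"
    using continuous_nonneg_integral_le_0_imp_0[OF \<open>open \<Omega>\<close>, of f x] x by (auto simp: has_integral_iff)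
  moreover have "0 \<le> \<kappa> * \<rho> x * (u x - c)\<^sup>2" "0 \<le> G x \<bullet> G x" using \<rho>(2)[OF x] \<kappa> by simp_all
  ultimately have "\<kappa> * \<rho> x * (u x - c)\<^sup>2 = 0" unfolding f_def by linarith
  then show ?thesis using \<rho>(2)[OF x] \<kappa> by simp
qed

text \<open>\<open>D\<close> is smooth only inside \<open>\<Omega>\<close> and may approach 0 at the
  boundary, so finiteness of \<open>mass\<close> is stated separately as integrability of
  \<open>M\<close>. Existence of a solution is claimed for \<open>\<mu>\<close>, which is compared
  with every density that admits a classical solution.\<close>

theorem theorem1p2:
  fixes \<Omega> :: "(real ^ 'd::finite) set"
    and D M \<mu> :: "real ^ 'd \<Rightarrow> real"
    and \<kappa> mass :: real
  assumes dim: "CARD('d) = 2 \<or> CARD('d) = 3"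
    and domain: "bounded_smooth_domain \<Omega>"
    and D_smooth: "smooth_on \<Omega> D"
    and D_pos: "\<forall>x\<in>\<Omega>. D x > 0"
    and M_def: "M = (\<lambda>x. 1 / D x)"
    and M_integrable: "M integrable_on \<Omega>"
    and mass_def: "mass = integral \<Omega> M"
    and \<mu>_def: "\<mu> = (\<lambda>x. M x / mass)"
    and \<kappa>_pos: "\<kappa> > 0"
  shows "trap_density \<Omega> \<mu>
    \<and> neumann_solution \<Omega> M \<kappa> \<mu> (\<lambda>x. mass / \<kappa>)
    \<and> (\<forall>u. neumann_solution \<Omega> M \<kappa> \<mu> u \<longrightarrow> (\<forall>x\<in>\<Omega>. u x = mass / \<kappa>))
    \<and> (\<forall>\<rho> u\<^sub>\<mu> u\<^sub>\<rho>. trap_density \<Omega> \<rho> \<and> neumann_solution \<Omega> M \<kappa> \<mu> u\<^sub>\<mu> \<and> neumann_solution \<Omega> M \<kappa> \<rho> u\<^sub>\<rho>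
          \<longrightarrow> worst_case \<Omega> u\<^sub>\<mu> \<le> worst_case \<Omega> u\<^sub>\<rho> \<and> sup_norm \<Omega> u\<^sub>\<mu> \<le> sup_norm \<Omega> u\<^sub>\<rho>)"
proof -
  have \<Omega>: "open \<Omega>" "\<Omega> \<noteq> {}" "bounded \<Omega>" using domain by (auto simp: bounded_smooth_domain_def)
  have M_pos: "0 < M x" if "x \<in> \<Omega>" for x using D_pos that by (simp add: M_def)
  have "Ck_on 0 \<Omega> D" using D_smooth unfolding smooth_on_def by blast
  then have cont_M: "continuous_on \<Omega> M"
    unfolding M_def using D_pos by (intro continuous_intros) auto
  have M_abs: "M absolutely_integrable_on \<Omega>"
    using M_integrable M_pos by (intro nonnegative_absolutely_integrable_1) (auto intro: less_imp_le)
  \<comment> \<open>This secures the normalisation: division by a zero \<open>mass\<close> would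
    make \<open>\<mu>\<close> identically 0.\<close>
  have mass_pos: "0 < mass"
  proof (rule ccontr)
    assume "\<not> 0 < mass"
    obtain x where x: "x \<in> \<Omega>" using \<Omega> by blast
    then have "M x = 0"
      using continuous_nonneg_integral_le_0_imp_0[OF \<Omega>(1) cont_M _ M_integrable _ x] M_pos \<open>\<not> 0 < mass\<close>
      by (force simp: mass_def)
    then show False using M_pos[OF x] by simp
  qed
  have \<mu>_eq: "\<kappa> * \<mu> x * (mass / \<kappa>) = M x" for x
    using mass_pos \<kappa>_pos by (simp add: \<mu>_def)
  have \<mu>_pos: "0 < \<mu> x" if "x \<in> \<Omega>" for x using M_pos[OF that] mass_pos by (simp add: \<mu>_def)
  have cont_\<mu>: "continuous_on \<Omega> \<mu>"
    unfolding \<mu>_def using cont_M mass_pos by (intro continuous_intros) auto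
  have trap_\<mu>: "trap_density \<Omega> \<mu>"
    unfolding trap_density_def
  proof
    show "\<forall>x\<in>\<Omega>. 0 \<le> \<mu> x" using \<mu>_pos by (auto intro: less_imp_le)
    show "(\<mu> has_integral 1) \<Omega>"
      using has_integral_divide[OF integrable_integral[OF M_integrable], of mass] mass_pos
      by (simp add: \<mu>_def mass_def)
  qed
  have uniq: "u x = mass / \<kappa>" if "neumann_solution \<Omega> M \<kappa> \<mu> u" "x \<in> \<Omega>" for u x
    using neumann_solution_unique_const[OF domain trap_\<mu> M_abs that(1) \<kappa>_pos cont_\<mu> \<mu>_pos \<mu>_eq that(2)] .
  have opt: "worst_case \<Omega> v \<le> worst_case \<Omega> u \<and> sup_norm \<Omega> v \<le> sup_norm \<Omega> u"
    if \<rho>: "trap_density \<Omega> \<rho>" and v: "neumann_solution \<Omega> M \<kappa> \<mu> v" and u: "neumann_solution \<Omega> M \<kappa> \<rho> u"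
    for \<rho> u v
  proof -
    obtain B where B: "\<And>x. x \<in> \<Omega> \<Longrightarrow> \<bar>u x\<bar> \<le> B" using neumann_solution_bounded[OF \<Omega>(3) u] by blast
    have "u x \<le> B" if "x \<in> \<Omega>" for x using B[OF that] by linarith
    \<comment> \<open>A real supremum is known to dominate its members only for sets bounded above;
      continuity of \<open>u\<close> on the compact closure provides the bound.\<close>
    then have bdd: "bdd_above (u ` \<Omega>)" "bdd_above ((\<lambda>x. \<bar>u x\<bar>) ` \<Omega>)"
      using B by (auto intro!: bdd_aboveI2)
    note bound = neumann_solution_upper_bound[OF domain \<rho> M_abs u \<kappa>_pos, folded mass_def]
    \<comment> \<open>Uniqueness replaces an arbitrary solution for \<open>\<mu>\<close> by the
      constant, whose positive value makes both functionals agree.\<close>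
    have "worst_case \<Omega> v = mass / \<kappa>" "sup_norm \<Omega> v = mass / \<kappa>"
      using uniq[OF v] \<Omega>(2) mass_pos \<kappa>_pos by (simp_all add: worst_case_def sup_norm_def)
    moreover have "mass / \<kappa> \<le> worst_case \<Omega> u"
      unfolding worst_case_def by (rule bound) (rule cSUP_upper[OF _ bdd(1)])
    moreover have "mass / \<kappa> \<le> sup_norm \<Omega> u"
      unfolding sup_norm_def by (rule bound) (rule order_trans[OF abs_ge_self cSUP_upper[OF _ bdd(2)]])
    ultimately show ?thesis by simp
  qed
  show ?thesis
    using trap_\<mu> neumann_solution_const[of \<Omega> \<kappa> \<mu> "mass / \<kappa>" M, OF \<mu>_eq] uniq opt by blast
qed

end
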